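(* Let $(W,S)$ be a Coxeter system. Let $F:\mathcal{SC}(W,S)\to\mathrm{Kar}(W)$ be the assignment given on objects by $I\mapsto I$ (i.e. the finitary subset $I$ is sent to the object of the Karoubi envelope given by the idempotent $w_I$), and on morphisms by sending a $(J,I)$-coset $p\in\mathrm{Hom}_{\mathcal{SC}}(I,J)$ to the element $\overline p\in\mathrm{Hom}_{\mathrm{Kar}(W)}(I,J)$. Then $F$ is a well-defined functor, and it is an equivalence of categories between $\mathcal{SC}(W,S)$ and $\mathrm{Kar}(W)$.
   Context: Let $(W,S)$ be a Coxeter system with identity $e$. For $I\subset S$ let $W_I$ be the parabolic subgroup generated by $I$; $I$ is finitary if $W_I$ is finite, and then $w_I$ is its longest element. For finitary $I,J$, a $(J,I)$-coset is a double coset $p\in W_J\backslash W/W_I$; it has a unique Bruhat-maximal element $\overline p$. The Coxeter monoid $(W,*,S)$ is the set $W$ with the associative product determined by $x*s=xs$ if $xs>x$ and $x*s=x$ if $xs<x$ ($x\in W$, $s\in S$). Singular Coxeter monoid: $\mathcal{SC}=\mathcal{SC}(W,S)$ is the category whose objects are the finitary subsets of $S$, with $\mathrm{Hom}_{\mathcal{SC}}(I,J)=W_J\backslash W/W_I$, the composition of a $(K,J)$-coset $p$ with a $(J,I)$-coset $q$ being $p*q:=W_K(\overline p*\overline q)W_I$. Karoubi envelope: $\mathrm{Kar}(W)$ is the Karoubi envelope (idempotent completion) of $(W,*,S)$ viewed as a category with one object. Its objects are the elements $w$ with $w*w=w$; these are exactly the $w_I$ with $I\subset S$ finitary, and the object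 $w_I$ is denoted $I$. Morphisms: $\mathrm{Hom}_{\mathrm{Kar}(W)}(I,J)=\{w\in W: w_J*w=w=w*w_I\}$, with composition $*$ and identity $w_I$ on $I$. *)

theory Defs
  imports
    "HOL-Library.Extended_Nat"
    "HOL-Algebra.Coset"
    "HOL-Algebra.Generated_Groups"
begin

section \<open>Coxeter systems\<close>

definition coxeter_matrix :: "'a set \<Rightarrow> ('a \<Rightarrow> 'a \<Rightarrow> enat) \<Rightarrow> bool" where
  "coxeter_matrix S m \<longleftrightarrow>
     (\<forall>s\<in>S. m s s = 1) \<and> (\<forall>s\<in>S. \<forall>t\<in>S. m s t = m t s \<and> (s \<noteq> t \<longrightarrow> 2 \<le> m s t))"

text \<open>Deletion of a factor \<open>(s t)\<^sup>n\<close> with \<open>n = m s t < \<infinity>\<close> from a word in the alphabet \<open>S\<close>.\<close>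

inductive coxeter_step :: "'a set \<Rightarrow> ('a \<Rightarrow> 'a \<Rightarrow> enat) \<Rightarrow> 'a list \<Rightarrow> 'a list \<Rightarrow> bool"
  for S m where
  "\<lbrakk>s \<in> S; t \<in> S; m s t = enat n; us \<in> lists S; vs \<in> lists S\<rbrakk>
     \<Longrightarrow> coxeter_step S m (us @ concat (replicate n [s, t]) @ vs) (us @ vs)"

definition word_prod :: "('a, 'b) monoid_scheme \<Rightarrow> 'a list \<Rightarrow> 'a" where
  "word_prod W ws = foldr (mult W) ws \<one>\<^bsub>W\<^esub>"

text \<open>The last two conditions say that \<open>W\<close> is presented by the generators \<open>S\<close> and the relations
  \<open>(s t)\<^bsup>m s t\<^esup> = 1\<close>, that is, \<open>W\<close> is the free monoid on \<open>S\<close> modulo the congruence generated by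
  them. Formal inverses of the generators are not needed, since \<open>m s s = 1\<close> yields the relation
  \<open>s s = 1\<close>. The set \<open>S\<close> may be infinite.\<close>

definition coxeter_system :: "('a, 'b) monoid_scheme \<Rightarrow> 'a set \<Rightarrow> bool" where
  "coxeter_system W S \<longleftrightarrow>
     group W \<and> S \<subseteq> carrier W \<and>
     (\<exists>m. coxeter_matrix S m \<and>
          generate W S = carrier W \<and>
          (\<forall>us\<in>lists S. \<forall>vs\<in>lists S.
             word_prod W us = word_prod W vs \<longleftrightarrow> equivclp (coxeter_step S m) us vs))"

definition cox_length :: "('a, 'b) monoid_scheme \<Rightarrow> 'a set \<Rightarrow> 'a \<Rightarrow> nat" where
  "cox_length W S w = (LEAST n. \<exists>ws\<in>lists S. length ws = n \<and> word_prod W ws = w)"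

definition reflections :: "('a, 'b) monoid_scheme \<Rightarrow> 'a set \<Rightarrow> 'a set" where
  "reflections W S = {w \<otimes>\<^bsub>W\<^esub> s \<otimes>\<^bsub>W\<^esub> inv\<^bsub>W\<^esub> w | w s. w \<in> carrier W \<and> s \<in> S}"

definition bruhat_step :: "('a, 'b) monoid_scheme \<Rightarrow> 'a set \<Rightarrow> 'a \<Rightarrow> 'a \<Rightarrow> bool" where
  "bruhat_step W S x y \<longleftrightarrow>
     x \<in> carrier W \<and> (\<exists>t\<in>reflections W S. y = x \<otimes>\<^bsub>W\<^esub> t) \<and> cox_length W S x < cox_length W S y"

definition bruhat_le :: "('a, 'b) monoid_scheme \<Rightarrow> 'a set \<Rightarrow> 'a \<Rightarrow> 'a \<Rightarrow> bool" where
  "bruhat_le W S = (bruhat_step W S)\<^sup>*\<^sup>*"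

definition bruhat_less :: "('a, 'b) monoid_scheme \<Rightarrow> 'a set \<Rightarrow> 'a \<Rightarrow> 'a \<Rightarrow> bool" where
  "bruhat_less W S x y \<longleftrightarrow> bruhat_le W S x y \<and> x \<noteq> y"

definition finitary :: "('a, 'b) monoid_scheme \<Rightarrow> 'a set \<Rightarrow> 'a set \<Rightarrow> bool" where
  "finitary W S I \<longleftrightarrow> I \<subseteq> S \<and> finite (generate W I)"

definition longest_elt :: "('a, 'b) monoid_scheme \<Rightarrow> 'a set \<Rightarrow> 'a set \<Rightarrow> 'a" where
  "longest_elt W S I =
     (THE w. w \<in> generate W I \<and> (\<forall>v\<in>generate W I. cox_length W S v \<le> cox_length W S w))"

definition double_coset :: "('a, 'b) monoid_scheme \<Rightarrow> 'a set \<Rightarrow> 'a \<Rightarrow> 'a set \<Rightarrow> 'a set" where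
  "double_coset W J x I = (generate W J #>\<^bsub>W\<^esub> x) <#>\<^bsub>W\<^esub> generate W I"

definition double_cosets :: "('a, 'b) monoid_scheme \<Rightarrow> 'a set \<Rightarrow> 'a set \<Rightarrow> 'a set set" where
  "double_cosets W J I = {double_coset W J x I | x. x \<in> carrier W}"

definition max_elt :: "('a, 'b) monoid_scheme \<Rightarrow> 'a set \<Rightarrow> 'a set \<Rightarrow> 'a" where
  "max_elt W S p = (THE x. x \<in> p \<and> \<not> (\<exists>y\<in>p. bruhat_less W S x y))"

section \<open>The Coxeter monoid\<close>

text \<open>The last condition fixes the values outside of the carrier, so that the product is unique
  as a function on the whole type.\<close>

definition is_coxeter_product ::
  "('a, 'b) monoid_scheme \<Rightarrow> 'a set \<Rightarrow> ('a \<Rightarrow> 'a \<Rightarrow> 'a) \<Rightarrow> bool" where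
  "is_coxeter_product W S f \<longleftrightarrow>
     monoid (W\<lparr>mult := f\<rparr>) \<and>
     (\<forall>x\<in>carrier W. \<forall>s\<in>S.
        (bruhat_less W S x (x \<otimes>\<^bsub>W\<^esub> s) \<longrightarrow> f x s = x \<otimes>\<^bsub>W\<^esub> s) \<and>
        (bruhat_less W S (x \<otimes>\<^bsub>W\<^esub> s) x \<longrightarrow> f x s = x)) \<and>
     (\<forall>x y. x \<notin> carrier W \<or> y \<notin> carrier W \<longrightarrow> f x y = undefined)"

definition coxeter_monoid ::
  "('a, 'b) monoid_scheme \<Rightarrow> 'a set \<Rightarrow> ('a, 'b) monoid_scheme" where
  "coxeter_monoid W S = W\<lparr>mult := (THE f. is_coxeter_product W S f)\<rparr>"

section \<open>Categories, functors and equivalences\<close>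

text \<open>Composition is indexed by the three objects involved and written in the order of function
  application: for \<open>g \<in> Hom C b c\<close> and \<open>f \<in> Hom C a b\<close>, the composite is \<open>Cmp C a b c g f\<close>.
  The indices matter because \<open>Hom\<close>-sets need not be disjoint: one subset of a group can be a double
  coset for several pairs of parabolic subgroups.\<close>

record ('o, 'm) cat =
  Ob :: "'o set"
  Hom :: "'o \<Rightarrow> 'o \<Rightarrow> 'm set"
  Cmp :: "'o \<Rightarrow> 'o \<Rightarrow> 'o \<Rightarrow> 'm \<Rightarrow> 'm \<Rightarrow> 'm"
  Idn :: "'o \<Rightarrow> 'm"

definition is_category :: "('o, 'm) cat \<Rightarrow> bool" where
  "is_category C \<longleftrightarrow>
     (\<forall>a\<in>Ob C. Idn C a \<in> Hom C a a) \<and>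
     (\<forall>a\<in>Ob C. \<forall>b\<in>Ob C. \<forall>c\<in>Ob C. \<forall>f\<in>Hom C a b. \<forall>g\<in>Hom C b c.
        Cmp C a b c g f \<in> Hom C a c) \<and>
     (\<forall>a\<in>Ob C. \<forall>b\<in>Ob C. \<forall>f\<in>Hom C a b.
        Cmp C a a b f (Idn C a) = f \<and> Cmp C a b b (Idn C b) f = f) \<and>
     (\<forall>a\<in>Ob C. \<forall>b\<in>Ob C. \<forall>c\<in>Ob C. \<forall>d\<in>Ob C.
        \<forall>f\<in>Hom C a b. \<forall>g\<in>Hom C b c. \<forall>h\<in>Hom C c d.
        Cmp C a b d (Cmp C b c d h g) f = Cmp C a c d h (Cmp C a b c g f))"

record ('o, 'm, 'p, 'n) fctr =
  ob_map :: "'o \<Rightarrow> 'p"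
  hom_map :: "'o \<Rightarrow> 'o \<Rightarrow> 'm \<Rightarrow> 'n"

definition is_functor :: "('o, 'm) cat \<Rightarrow> ('p, 'n) cat \<Rightarrow> ('o, 'm, 'p, 'n) fctr \<Rightarrow> bool" where
  "is_functor C D F \<longleftrightarrow>
     is_category C \<and> is_category D \<and>
     (\<forall>a\<in>Ob C. ob_map F a \<in> Ob D) \<and>
     (\<forall>a\<in>Ob C. \<forall>b\<in>Ob C. \<forall>f\<in>Hom C a b. hom_map F a b f \<in> Hom D (ob_map F a) (ob_map F b)) \<and>
     (\<forall>a\<in>Ob C. hom_map F a a (Idn C a) = Idn D (ob_map F a)) \<and>
     (\<forall>a\<in>Ob C. \<forall>b\<in>Ob C. \<forall>c\<in>Ob C. \<forall>f\<in>Hom C a b. \<forall>g\<in>Hom C b c.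
        hom_map F a c (Cmp C a b c g f) =
        Cmp D (ob_map F a) (ob_map F b) (ob_map F c) (hom_map F b c g) (hom_map F a b f))"

definition id_fctr :: "('o, 'm, 'o, 'm) fctr" where
  "id_fctr = \<lparr>ob_map = (\<lambda>a. a), hom_map = (\<lambda>a b f. f)\<rparr>"

definition comp_fctr ::
  "('p, 'n, 'q, 'l) fctr \<Rightarrow> ('o, 'm, 'p, 'n) fctr \<Rightarrow> ('o, 'm, 'q, 'l) fctr" where
  "comp_fctr G F =
     \<lparr>ob_map = (\<lambda>a. ob_map G (ob_map F a)),
      hom_map = (\<lambda>a b f. hom_map G (ob_map F a) (ob_map F b) (hom_map F a b f))\<rparr>"

definition is_iso :: "('o, 'm) cat \<Rightarrow> 'o \<Rightarrow> 'o \<Rightarrow> 'm \<Rightarrow> bool" where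
  "is_iso C a b f \<longleftrightarrow>
     f \<in> Hom C a b \<and>
     (\<exists>g\<in>Hom C b a. Cmp C a b a g f = Idn C a \<and> Cmp C b a b f g = Idn C b)"

definition is_nat_iso :: "('o, 'm) cat \<Rightarrow> ('p, 'n) cat \<Rightarrow>
    ('o, 'm, 'p, 'n) fctr \<Rightarrow> ('o, 'm, 'p, 'n) fctr \<Rightarrow> ('o \<Rightarrow> 'n) \<Rightarrow> bool" where
  "is_nat_iso C D F G \<eta> \<longleftrightarrow>
     (\<forall>a\<in>Ob C. is_iso D (ob_map F a) (ob_map G a) (\<eta> a)) \<and>
     (\<forall>a\<in>Ob C. \<forall>b\<in>Ob C. \<forall>f\<in>Hom C a b.
        Cmp D (ob_map F a) (ob_map F b) (ob_map G b) (\<eta> b) (hom_map F a b f) =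
        Cmp D (ob_map F a) (ob_map G a) (ob_map G b) (hom_map G a b f) (\<eta> a))"

definition is_equivalence ::
  "('o, 'm) cat \<Rightarrow> ('p, 'n) cat \<Rightarrow> ('o, 'm, 'p, 'n) fctr \<Rightarrow> bool" where
  "is_equivalence C D F \<longleftrightarrow>
     is_functor C D F \<and>
     (\<exists>G \<eta> \<epsilon>. is_functor D C G \<and>
        is_nat_iso C C id_fctr (comp_fctr G F) \<eta> \<and>
        is_nat_iso D D (comp_fctr F G) id_fctr \<epsilon>)"

section \<open>The two categories and the functor\<close>

definition singular_coxeter_monoid ::
  "('a, 'b) monoid_scheme \<Rightarrow> 'a set \<Rightarrow> ('a set, 'a set) cat" where
  "singular_coxeter_monoid W S =
     \<lparr>Ob = {I. finitary W S I},
      Hom = (\<lambda>I J. double_cosets W J I),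
      Cmp = (\<lambda>I J K p q.
        double_coset W K (max_elt W S p \<otimes>\<^bsub>coxeter_monoid W S\<^esub> max_elt W S q) I),
      Idn = (\<lambda>I. double_coset W I \<one>\<^bsub>W\<^esub> I)\<rparr>"

text \<open>The Karoubi envelope of a monoid, regarded as a category with one object.\<close>

definition karoubi :: "('a, 'b) monoid_scheme \<Rightarrow> ('a, 'a) cat" where
  "karoubi M =
     \<lparr>Ob = {e \<in> carrier M. e \<otimes>\<^bsub>M\<^esub> e = e},
      Hom = (\<lambda>e f. {w \<in> carrier M. f \<otimes>\<^bsub>M\<^esub> w = w \<and> w = w \<otimes>\<^bsub>M\<^esub> e}),
      Cmp = (\<lambda>e f g v w. v \<otimes>\<^bsub>M\<^esub> w),
      Idn = (\<lambda>e. e)\<rparr>"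

definition SC_to_Kar ::
  "('a, 'b) monoid_scheme \<Rightarrow> 'a set \<Rightarrow> ('a set, 'a set, 'a, 'a) fctr" where
  "SC_to_Kar W S =
     \<lparr>ob_map = (\<lambda>I. longest_elt W S I),
      hom_map = (\<lambda>I J p. max_elt W S p)\<rparr>"

end

theory Submission
  imports Defs
begin

text \<open>The theorem holds because every double coset \<open>p \<in> W\<^sub>J \ W / W\<^sub>I\<close> can be recovered from its maximal
  element, and because the elements that occur in this way are those \<open>w\<close> with
  \<open>w\<^sub>J \<star> w = w = w \<star> w\<^sub>I\<close>, where \<open>\<star>\<close> is the product of the Coxeter monoid. Everything follows from the
  formula \<open>w\<^sub>J \<star> x \<star> w\<^sub>I\<close> for the maximal element of \<open>W\<^sub>J x W\<^sub>I\<close> (\<open>max_elt_double_coset\<close>). This expression does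
  not change when \<open>x\<close> is replaced by another element of the coset, it lies in the coset, and an
  element of the coset that cannot be increased by the generators in \<open>J\<close> on the left and in \<open>I\<close> on
  the right absorbs \<open>w\<^sub>J\<close> and \<open>w\<^sub>I\<close>, hence is equal to it. Functoriality is then associativity of \<open>\<star>\<close>
  together with idempotency of the longest elements, and the functor is bijective on morphisms
  (\<open>bij_betw_max_elt\<close>).

  It is also surjective on objects (\<open>idempotent_is_longest\<close>). If \<open>w \<star> w = w\<close>, then multiplication by
  the letters of a reduced word of \<open>w\<close> cannot increase \<open>w\<close>; so the subgroup generated by these
  letters is absorbed by \<open>w\<close>, which bounds the length of its elements. It is therefore finite, and \<open>w\<close>
  is its longest element. A fully faithful functor that is surjective on objects is an equivalence.

  The product \<open>\<star>\<close> comes from two families of operators on \<open>W\<close>: multiplication by a generator on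
  the left or on the right, carried out only if it increases the length. By the exchange condition
  the left operators commute with the right ones (\<open>up_left_up_right\<close>). Hence an operator composed of
  right steps is determined by its value at the identity, since \<open>x\<close> itself is the value at the
  identity of a composite of left steps. This makes \<open>\<star>\<close> well defined and associative without
  Matsumoto's theorem.

  The exchange condition (\<open>exchange\<close>) is obtained from the presentation by counting, for a word and a
  reflection \<open>r\<close>, how often the gallery described by the word crosses the wall of \<open>r\<close>. The parity of this
  number depends only on the group element.\<close>

section \<open>Fully faithful functors that are surjective on objects\<close>

lemma fully_faithful_surjective_imp_equivalence:
  assumes F: "is_functor C D F"
    and surj: "ob_map F ` Ob C = Ob D"
    and ff: "\<And>a b. \<lbrakk>a \<in> Ob C; b \<in> Ob C\<rbrakk> \<Longrightarrow>
      bij_betw (hom_map F a b) (Hom C a b) (Hom D (ob_map F a) (ob_map F b))"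
  shows "is_equivalence C D F"
proof -
  define pre where "pre = inv_into (Ob C) (ob_map F)"
  define h where "h = (\<lambda>a b. inv_into (Hom C a b) (hom_map F a b))"
  define G where "G = \<lparr>ob_map = pre, hom_map = (\<lambda>d e g. h (pre d) (pre e) g)\<rparr>"
  define \<eta> where "\<eta> = (\<lambda>a. h a (pre (ob_map F a)) (Idn D (ob_map F a)))"
  have pre: "pre d \<in> Ob C" "ob_map F (pre d) = d" if "d \<in> Ob D" for d
    using that surj unfolding pre_def by (auto intro: inv_into_into f_inv_into_f)
  have h: "h a b g \<in> Hom C a b" "hom_map F a b (h a b g) = g"
    if "a \<in> Ob C" "b \<in> Ob C" "g \<in> Hom D (ob_map F a) (ob_map F b)" for a b g
    using ff[OF that(1,2)] that(3) unfolding h_def bij_betw_def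
    by (auto intro: inv_into_into f_inv_into_f)
  have faithful: "f = f'" if "a \<in> Ob C" "b \<in> Ob C" "f \<in> Hom C a b" "f' \<in> Hom C a b"
      "hom_map F a b f = hom_map F a b f'" for a b f f'
    using ff[OF that(1,2)] that(3-5) unfolding bij_betw_def by (meson inj_onD)
  have C: "is_category C" and D: "is_category D"
    using F by (auto simp: is_functor_def)
  have Fob: "ob_map F a \<in> Ob D" if "a \<in> Ob C" for a
    using F that by (auto simp: is_functor_def)
  have Fhom: "hom_map F a b f \<in> Hom D (ob_map F a) (ob_map F b)"
    if "a \<in> Ob C" "b \<in> Ob C" "f \<in> Hom C a b" for a b f
    using F that by (auto simp: is_functor_def)
  have Fid: "hom_map F a a (Idn C a) = Idn D (ob_map F a)" if "a \<in> Ob C" for a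
    using F that by (auto simp: is_functor_def)
  have Fcmp: "hom_map F a c (Cmp C a b c g f) =
      Cmp D (ob_map F a) (ob_map F b) (ob_map F c) (hom_map F b c g) (hom_map F a b f)"
    if "a \<in> Ob C" "b \<in> Ob C" "c \<in> Ob C" "f \<in> Hom C a b" "g \<in> Hom C b c" for a b c f g
    using F that by (auto simp: is_functor_def)
  have Cid: "Idn C a \<in> Hom C a a" if "a \<in> Ob C" for a
    using C that by (auto simp: is_category_def)
  have Did: "Idn D a \<in> Hom D a a" if "a \<in> Ob D" for a
    using D that by (auto simp: is_category_def)
  have Ccmp: "Cmp C a b c g f \<in> Hom C a c"
    if "a \<in> Ob C" "b \<in> Ob C" "c \<in> Ob C" "f \<in> Hom C a b" "g \<in> Hom C b c" for a b c f g
    using C that by (auto simp: is_category_def)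
  have Dcmp: "Cmp D a b c g f \<in> Hom D a c"
    if "a \<in> Ob D" "b \<in> Ob D" "c \<in> Ob D" "f \<in> Hom D a b" "g \<in> Hom D b c" for a b c f g
    using D that by (auto simp: is_category_def)
  have Dunit: "Cmp D a a b f (Idn D a) = f" "Cmp D a b b (Idn D b) f = f"
    if "a \<in> Ob D" "b \<in> Ob D" "f \<in> Hom D a b" for a b f
    using D that by (auto simp: is_category_def)
  have hG: "h (pre d) (pre e) g \<in> Hom C (pre d) (pre e)"
    "hom_map F (pre d) (pre e) (h (pre d) (pre e) g) = g"
    if "d \<in> Ob D" "e \<in> Ob D" "g \<in> Hom D d e" for d e g
    using h[of "pre d" "pre e" g] pre that by auto
  \<comment> \<open>An equation in \<open>C\<close> can be checked after applying \<open>F\<close>; this settles the functor laws of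
    \<open>G\<close> and, further below, invertibility and naturality of the unit.\<close>
  have functor_G: "is_functor D C G"
    unfolding is_functor_def G_def fctr.simps
  proof (intro conjI ballI)
    show "is_category D" "is_category C" by fact+
  next
    fix d assume d: "d \<in> Ob D"
    show "pre d \<in> Ob C" using pre d by simp
    show "h (pre d) (pre d) (Idn D d) = Idn C (pre d)"
      by (rule faithful[of "pre d" "pre d"]) (simp_all add: pre hG Did d Cid Fid)
  next
    fix d e g assume "d \<in> Ob D" "e \<in> Ob D" "g \<in> Hom D d e"
    then show "h (pre d) (pre e) g \<in> Hom C (pre d) (pre e)" by (rule hG)
  next
    fix a b c f g assume *: "a \<in> Ob D" "b \<in> Ob D" "c \<in> Ob D" "f \<in> Hom D a b" "g \<in> Hom D b c"
    show "h (pre a) (pre c) (Cmp D a b c g f) =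
      Cmp C (pre a) (pre b) (pre c) (h (pre b) (pre c) g) (h (pre a) (pre b) f)"
      by (rule faithful[of "pre a" "pre c"])
        (simp_all add: pre hG * Dcmp[OF *] Fcmp Ccmp[of "pre a" "pre b" "pre c"])
  qed
  have \<eta>: "\<eta> a \<in> Hom C a (pre (ob_map F a))"
    "hom_map F a (pre (ob_map F a)) (\<eta> a) = Idn D (ob_map F a)" if "a \<in> Ob C" for a
    unfolding \<eta>_def using h[of a "pre (ob_map F a)" "Idn D (ob_map F a)"] that
    by (simp_all add: pre Fob Did)
  \<comment> \<open>Although \<open>F (G d) = d\<close>, the object \<open>G (F a)\<close> may differ from \<open>a\<close>; the isomorphism between them is the
    preimage of an identity under \<open>F\<close>.\<close>
  have "is_nat_iso C C id_fctr (comp_fctr G F) \<eta>"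
    unfolding is_nat_iso_def id_fctr_def comp_fctr_def G_def fctr.simps
  proof (intro conjI ballI)
    fix a assume a: "a \<in> Ob C"
    let ?b = "pre (ob_map F a)" and ?i = "Idn D (ob_map F a)"
    let ?g = "h ?b a ?i"
    have b: "?b \<in> Ob C" "ob_map F ?b = ob_map F a" using a by (simp_all add: pre Fob)
    have g: "?g \<in> Hom C ?b a" "hom_map F ?b a ?g = ?i"
      using h[of ?b a ?i] a b by (simp_all add: Did Fob)
    have "Cmp C a ?b a ?g (\<eta> a) = Idn C a"
      by (rule faithful[of a a])
        (simp_all add: a b g \<eta> Ccmp[of a ?b a] Cid Fid Fcmp Dunit Did Fob)
    moreover have "Cmp C ?b a ?b (\<eta> a) ?g = Idn C ?b"
      by (rule faithful[of ?b ?b])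
        (simp_all add: a b g \<eta> Ccmp[of ?b a ?b] Cid Fid Fcmp Dunit Did Fob)
    ultimately show "is_iso C a ?b (\<eta> a)"
      unfolding is_iso_def using g(1) \<eta>(1)[OF a] by blast
  next
    fix a b f assume *: "a \<in> Ob C" "b \<in> Ob C" "f \<in> Hom C a b"
    let ?a = "pre (ob_map F a)" and ?b = "pre (ob_map F b)"
    show "Cmp C a b ?b (\<eta> b) f = Cmp C a ?a ?b (h ?a ?b (hom_map F a b f)) (\<eta> a)"
      by (rule faithful[of a ?b])
        (simp_all add: * pre Fob \<eta> hG Fhom Ccmp[of a b ?b] Ccmp[of a ?a ?b] Fcmp Dunit)
  qed
  moreover have "is_nat_iso D D (comp_fctr F G) id_fctr (Idn D)"
    unfolding is_nat_iso_def is_iso_def id_fctr_def comp_fctr_def G_def fctr.simps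
    by (auto simp: pre hG Did Dunit intro!: bexI[of _ "Idn D _"])
  ultimately show ?thesis
    unfolding is_equivalence_def using F functor_G by blast
qed

lemma karoubi_is_category:
  assumes "monoid M"
  shows "is_category (karoubi M)"
proof -
  interpret monoid M by fact
  show ?thesis
    unfolding is_category_def karoubi_def cat.simps mem_Collect_eq
  proof (intro conjI ballI)
    fix a b c f g
    assume "a \<in> {e \<in> carrier M. e \<otimes>\<^bsub>M\<^esub> e = e}" "c \<in> {e \<in> carrier M. e \<otimes>\<^bsub>M\<^esub> e = e}"
      and f: "f \<in> {w \<in> carrier M. b \<otimes>\<^bsub>M\<^esub> w = w \<and> w = w \<otimes>\<^bsub>M\<^esub> a}"
      and g: "g \<in> {w \<in> carrier M. c \<otimes>\<^bsub>M\<^esub> w = w \<and> w = w \<otimes>\<^bsub>M\<^esub> b}"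
    then show "g \<otimes>\<^bsub>M\<^esub> f \<in> carrier M" "c \<otimes>\<^bsub>M\<^esub> (g \<otimes>\<^bsub>M\<^esub> f) = g \<otimes>\<^bsub>M\<^esub> f"
      "g \<otimes>\<^bsub>M\<^esub> f = g \<otimes>\<^bsub>M\<^esub> f \<otimes>\<^bsub>M\<^esub> a"
      using m_assoc[of c g f] m_assoc[of g f a] by auto
  qed (auto intro: m_assoc)
qed

section \<open>Words and length\<close>

locale coxeter = group W for W :: "('a, 'b) monoid_scheme" (structure) +
  fixes S :: "'a set"
  assumes coxeter: "coxeter_system W S"
begin

abbreviation wp :: "'a list \<Rightarrow> 'a" where "wp \<equiv> word_prod W"
abbreviation len :: "'a \<Rightarrow> nat" where "len \<equiv> cox_length W S"

declare in_lists_conv_set [simp] ball_Un [simp]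

lemma S_closed [simp]: "s \<in> S \<Longrightarrow> s \<in> carrier W"
  using coxeter by (auto simp: coxeter_system_def)

lemma wp_Nil [simp]: "wp [] = \<one>"
  and wp_Cons [simp]: "wp (s # ws) = s \<otimes> wp ws"
  by (simp_all add: word_prod_def)

lemma wp_closed [simp]: "ws \<in> lists S \<Longrightarrow> wp ws \<in> carrier W"
  by (induction ws) auto

lemma wp_append: "\<lbrakk>us \<in> lists S; vs \<in> lists S\<rbrakk> \<Longrightarrow> wp (us @ vs) = wp us \<otimes> wp vs"
  by (induction us) (auto simp: m_assoc)

lemma gen_square [simp]:
  assumes "s \<in> S" shows "s \<otimes> s = \<one>"
proof -
  obtain m where m: "coxeter_matrix S m"
    and pres: "\<And>us vs. us \<in> lists S \<Longrightarrow> vs \<in> lists S \<Longrightarrow>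
      word_prod W us = word_prod W vs \<longleftrightarrow> equivclp (coxeter_step S m) us vs"
    using coxeter by (auto simp: coxeter_system_def)
  have "m s s = enat 1" using m assms by (simp add: coxeter_matrix_def one_enat_def)
  then have "coxeter_step S m ([] @ concat (replicate 1 [s, s]) @ []) ([] @ [])"
    using assms by (intro coxeter_step.intros) auto
  then have "equivclp (coxeter_step S m) [s, s] []" by auto
  then have "wp [s, s] = wp []" using pres[of "[s, s]" "[]"] assms by auto
  then show ?thesis using assms by simp
qed

lemma gen_inv [simp]: "s \<in> S \<Longrightarrow> inv s = s"
  by (rule inv_equality) auto

lemma gen_cancel [simp]: "\<lbrakk>s \<in> S; x \<in> carrier W\<rbrakk> \<Longrightarrow> s \<otimes> (s \<otimes> x) = x"
  by (simp add: m_assoc[symmetric])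

lemma gen_cancel_right [simp]: "\<lbrakk>s \<in> S; x \<in> carrier W\<rbrakk> \<Longrightarrow> x \<otimes> s \<otimes> s = x"
  by (simp add: m_assoc)

text \<open>A function on words that is insensitive to relators factors through the group. The relators enter
  only as words \<open>(s t)\<^sup>n\<close> with trivial product, so that the Coxeter matrix does not appear in later
  arguments.\<close>

lemma word_invariant:
  assumes eq: "wp us = wp vs" and words: "us \<in> lists S" "vs \<in> lists S"
    and inv: "\<And>s t n us vs. \<lbrakk>s \<in> S; t \<in> S; us \<in> lists S; vs \<in> lists S;
        wp (concat (replicate n [s, t])) = \<one>\<rbrakk>
      \<Longrightarrow> P (us @ concat (replicate n [s, t]) @ vs) = P (us @ vs)"
  shows "P us = P vs"
proof -
  obtain m where m: "coxeter_matrix S m"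
    and pres: "\<And>us vs. us \<in> lists S \<Longrightarrow> vs \<in> lists S \<Longrightarrow>
      word_prod W us = word_prod W vs \<longleftrightarrow> equivclp (coxeter_step S m) us vs"
    using coxeter by (auto simp: coxeter_system_def)
  have step: "P a = P b" if "coxeter_step S m a b" for a b
    using that
  proof cases
    case (1 s t n us vs)
    let ?r = "concat (replicate n [s, t])"
    have r: "?r \<in> lists S" using 1 by (auto split: if_splits)
    have "coxeter_step S m ([] @ ?r @ []) ([] @ [])"
      using 1 by (intro coxeter_step.intros) auto
    then have "equivclp (coxeter_step S m) ?r []" by auto
    then have "wp ?r = \<one>" using pres[of ?r "[]"] r by auto
    then show ?thesis using 1 inv[of s t us vs n] by simp
  qed
  have "equivclp (coxeter_step S m) us vs" using pres eq words by blast
  then show ?thesis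
    by (induction rule: equivclp_induct) (auto dest: step)
qed

lemma generate_iff_word:
  assumes "I \<subseteq> S"
  shows "x \<in> generate W I \<longleftrightarrow> (\<exists>ws\<in>lists I. wp ws = x)"
proof
  assume "x \<in> generate W I"
  then show "\<exists>ws\<in>lists I. wp ws = x"
  proof (induction rule: generate.induct)
    case one
    show ?case by (rule bexI[of _ "[]"]) auto
  next
    case (incl h)
    then show ?case using assms by (intro bexI[of _ "[h]"]) auto
  next
    case (inv h)
    then show ?case using assms by (intro bexI[of _ "[h]"]) auto
  next
    case (eng h1 h2)
    then obtain us vs where "us \<in> lists I" "vs \<in> lists I" "wp us = h1" "wp vs = h2" by blast
    moreover from this have "us \<in> lists S" "vs \<in> lists S" using lists_mono[OF assms] by blast+
    ultimately show ?case by (intro bexI[of _ "us @ vs"]) (simp_all add: wp_append)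
  qed
next
  assume "\<exists>ws\<in>lists I. wp ws = x"
  then obtain ws where "ws \<in> lists I" "wp ws = x" by blast
  then show "x \<in> generate W I"
    by (induction ws arbitrary: x) (auto intro: generate.intros)
qed

lemma ex_word: "x \<in> carrier W \<Longrightarrow> \<exists>ws\<in>lists S. wp ws = x"
  using generate_iff_word[of S x] coxeter by (auto simp: coxeter_system_def)

lemma len_le_length: "ws \<in> lists S \<Longrightarrow> len (wp ws) \<le> length ws"
  unfolding cox_length_def by (rule Least_le) auto

definition reduced :: "'a list \<Rightarrow> bool" where
  "reduced ws \<longleftrightarrow> ws \<in> lists S \<and> length ws = len (wp ws)"

lemma ex_reduced:
  assumes "x \<in> carrier W" shows "\<exists>ws. reduced ws \<and> wp ws = x"
proof -
  have "\<exists>n. \<exists>ws\<in>lists S. length ws = n \<and> wp ws = x" using ex_word[OF assms] by blast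
  from LeastI_ex[OF this] show ?thesis
    unfolding reduced_def cox_length_def by blast
qed

lemma len_one [simp]: "len \<one> = 0"
  using len_le_length[of "[]"] by simp

lemma len_gen_mult_le:
  assumes "s \<in> S" "x \<in> carrier W" shows "len (s \<otimes> x) \<le> Suc (len x)"
proof -
  obtain ws where "reduced ws" "wp ws = x" using ex_reduced assms by blast
  then show ?thesis using len_le_length[of "s # ws"] assms by (auto simp: reduced_def)
qed

text \<open>Every relator has even length, so the parity of the length of a word depends only on the
  group element.\<close>

lemma even_length_word:
  assumes "ws \<in> lists S" shows "even (length ws) \<longleftrightarrow> even (len (wp ws))"
proof -
  obtain vs where vs: "reduced vs" "wp vs = wp ws" using ex_reduced[OF wp_closed[OF assms]] by blast
  have relator: "length (concat (replicate n [s, t])) = 2 * n" for n and s t :: 'a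
    by (induction n) simp_all
  have "even (length ws) = even (length vs)"
  proof (rule word_invariant[where P = "\<lambda>ws. even (length ws)"])
    show "wp ws = wp vs" "ws \<in> lists S" "vs \<in> lists S" using vs assms by (simp_all add: reduced_def)
  qed (simp add: relator)
  then show ?thesis using vs by (auto simp: reduced_def)
qed

lemma even_len_gen_mult:
  assumes "s \<in> S" "x \<in> carrier W" shows "even (len (s \<otimes> x)) \<longleftrightarrow> odd (len x)"
proof -
  obtain ws where "reduced ws" "wp ws = x" using ex_reduced assms by blast
  then show ?thesis using even_length_word[of "s # ws"] assms by (auto simp: reduced_def)
qed

text \<open>The lengths differ by at most one, and they cannot agree because their parities differ.\<close>

lemma len_gen_mult:
  assumes "s \<in> S" "x \<in> carrier W"
  shows "len (s \<otimes> x) = Suc (len x) \<or> len x = Suc (len (s \<otimes> x))"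
proof -
  have "len (s \<otimes> x) \<noteq> len x" using even_len_gen_mult[OF assms] by auto
  moreover have "len x \<le> Suc (len (s \<otimes> x))"
    using len_gen_mult_le[of s "s \<otimes> x"] assms by simp
  ultimately show ?thesis using len_gen_mult_le[OF assms] by linarith
qed

lemma wp_rev: "ws \<in> lists S \<Longrightarrow> wp (rev ws) = inv (wp ws)"
proof (induction ws)
  case (Cons s ws)
  then have "rev ws \<in> lists S" by auto
  then show ?case using Cons wp_append[of "rev ws" "[s]"] by (simp add: inv_mult_group)
qed simp

lemma len_inv:
  assumes "x \<in> carrier W" shows "len (inv x) = len x"
proof -
  have le: "len (inv y) \<le> len y" if y: "y \<in> carrier W" for y
  proof -
    obtain ws where "reduced ws" "wp ws = y" using ex_reduced[OF y] by blast
    moreover from this have "rev ws \<in> lists S" by (auto simp: reduced_def)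
    ultimately show ?thesis using len_le_length[of "rev ws"] by (simp add: wp_rev reduced_def)
  qed
  show ?thesis using le[OF assms] le[OF inv_closed[OF assms]] assms by simp
qed

lemma len_mult_gen:
  assumes "s \<in> S" "x \<in> carrier W"
  shows "len (x \<otimes> s) = Suc (len x) \<or> len x = Suc (len (x \<otimes> s))"
proof -
  have "inv (x \<otimes> s) = s \<otimes> inv x" using assms by (simp add: inv_mult_group)
  then have "len (s \<otimes> inv x) = len (x \<otimes> s)" using len_inv[of "x \<otimes> s"] assms by simp
  then show ?thesis using len_gen_mult[of s "inv x"] len_inv[of x] assms by simp
qed

lemma reduced_ConsD:
  assumes "reduced (s # ws)"
  shows "s \<in> S" "reduced ws" "len (wp ws) < len (s \<otimes> wp ws)"
  using assms len_le_length[of ws] len_gen_mult_le[of s "wp ws"] unfolding reduced_def by auto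

lemma reduced_snocD:
  assumes "reduced (ws @ [s])"
  shows "s \<in> S" "reduced ws" "len (wp ws) < len (wp ws \<otimes> s)"
  using assms len_le_length[of ws] len_mult_gen[of s "wp ws"]
  unfolding reduced_def by (auto simp: wp_append)

section \<open>The exchange condition\<close>

text \<open>For \<open>ws = [s\<^sub>1, \<dots>, s\<^sub>k]\<close> this is the number of indices \<open>i\<close> with
  \<open>r = s\<^sub>1 \<cdots> s\<^sub>i\<^sub>-\<^sub>1 s\<^sub>i s\<^sub>i\<^sub>-\<^sub>1 \<cdots> s\<^sub>1\<close>, that is, how often the gallery with type \<open>ws\<close> that starts in the
  fundamental chamber crosses the wall fixed by \<open>r\<close>.\<close>

fun crossings :: "'a list \<Rightarrow> 'a \<Rightarrow> nat" where
  "crossings [] r = 0"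
| "crossings (s # ws) r = of_bool (r = s) + crossings ws (s \<otimes> r \<otimes> s)"

text \<open>After reading \<open>us\<close> the gallery stands in the chamber of \<open>wp us\<close>; seen from there, the wall of \<open>r\<close> is
  the wall of a conjugate.\<close>

lemma crossings_append:
  assumes "us \<in> lists S" "r \<in> carrier W"
  shows "crossings (us @ vs) r = crossings us r + crossings vs (inv (wp us) \<otimes> r \<otimes> wp us)"
  using assms
proof (induction us arbitrary: r)
  case (Cons s us)
  then show ?case by (auto simp: inv_mult_group m_assoc)
qed auto

lemma gen_conj_eq_iff:
  assumes "s \<in> S" "r \<in> carrier W" "q \<in> carrier W"
  shows "s \<otimes> r \<otimes> s = q \<longleftrightarrow> r = s \<otimes> q \<otimes> s"
  using assms by (auto simp: m_assoc)

text \<open>The walls crossed by the gallery of type \<open>s t s t \<dots>\<close> belong to the reflections \<open>s, s t s, s t s t s, \<dots>\<close>.\<close>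

lemma crossings_alternating:
  assumes "s \<in> S" "t \<in> S" "r \<in> carrier W"
  shows "crossings (concat (replicate k [s, t])) r =
    (\<Sum>i<2 * k. of_bool (r = (s \<otimes> t) [^] i \<otimes> s))"
  using assms(3)
proof (induction k arbitrary: r)
  case (Suc k)
  have shift: "(t \<otimes> (s \<otimes> r \<otimes> s) \<otimes> t = (s \<otimes> t) [^] i \<otimes> s) =
      (r = (s \<otimes> t) [^] Suc (Suc i) \<otimes> s)" for i
  proof -
    have "(s \<otimes> t) [^] Suc (Suc i) = (s \<otimes> t) \<otimes> ((s \<otimes> t) [^] i \<otimes> (s \<otimes> t))"
      using assms by (metis S_closed m_closed nat_pow_Suc nat_pow_Suc2)
    then have "(s \<otimes> t) [^] Suc (Suc i) \<otimes> s = s \<otimes> (t \<otimes> ((s \<otimes> t) [^] i \<otimes> s) \<otimes> t) \<otimes> s"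
      using assms by (simp add: m_assoc)
    then show ?thesis using assms Suc.prems by (simp add: gen_conj_eq_iff)
  qed
  have "crossings (concat (replicate (Suc k) [s, t])) r =
      of_bool (r = s) + (of_bool (r = s \<otimes> t \<otimes> s) +
        (\<Sum>i<2 * k. of_bool (r = (s \<otimes> t) [^] Suc (Suc i) \<otimes> s)))"
    using assms Suc by (simp add: gen_conj_eq_iff shift del: nat_pow_Suc)
  also have "\<dots> = (\<Sum>i<Suc (Suc (2 * k)). of_bool (r = (s \<otimes> t) [^] i \<otimes> s))"
    unfolding sum.lessThan_Suc_shift using assms by (simp add: comp_def del: nat_pow_Suc)
  finally show ?case by simp
qed simp

lemma even_crossings_relator:
  assumes "s \<in> S" "t \<in> S" "r \<in> carrier W" "wp (concat (replicate n [s, t])) = \<one>"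
  shows "even (crossings (concat (replicate n [s, t])) r)"
proof -
  have "wp (concat (replicate k [s, t])) = (s \<otimes> t) [^] k" for k
  proof (induction k)
    case (Suc k)
    have "wp (concat (replicate (Suc k) [s, t])) = (s \<otimes> t) \<otimes> (s \<otimes> t) [^] k"
      using Suc assms(1,2) by (simp add: m_assoc)
    also have "\<dots> = (s \<otimes> t) [^] Suc k"
      using assms(1,2) by (intro nat_pow_Suc2[symmetric]) simp
    finally show ?case .
  qed simp
  then have per: "(s \<otimes> t) [^] n = \<one>" using assms by simp
  have split: "(\<Sum>i<n + m. f i) = (\<Sum>i<n. f i) + (\<Sum>i<m. f (n + i))" for f :: "nat \<Rightarrow> nat" and m
    by (induction m) simp_all
  \<comment> \<open>The list of walls of \<open>(s t)\<^sup>n\<close> has \<open>2 n\<close> entries and period \<open>n\<close>, so each wall occurs an even number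
    of times.\<close>
  have "(s \<otimes> t) [^] (n + i) = (s \<otimes> t) [^] i" for i
    using assms(1,2) per by (simp add: nat_pow_mult[symmetric])
  then have "(\<Sum>i<n + n. of_bool (r = (s \<otimes> t) [^] i \<otimes> s)) =
      2 * (\<Sum>i<n. of_bool (r = (s \<otimes> t) [^] i \<otimes> s) :: nat)"
    by (simp add: split mult_2)
  then show ?thesis using crossings_alternating[OF assms(1-3)] by (simp add: mult_2)
qed

lemma even_crossings_cong:
  assumes "wp us = wp vs" "us \<in> lists S" "vs \<in> lists S" "r \<in> carrier W"
  shows "even (crossings us r) = even (crossings vs r)"
  using assms(1-3)
proof (rule word_invariant[where P = "\<lambda>ws. even (crossings ws r)"])
  fix s t n us vs
  assume *: "s \<in> S" "t \<in> S" "us \<in> lists S" "vs \<in> lists S"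
    and rel: "wp (concat (replicate n [s, t])) = \<one>"
  let ?q = "inv (wp us) \<otimes> r \<otimes> wp us"
  have word: "concat (replicate n [s, t]) \<in> lists S" using * by auto
  have q: "?q \<in> carrier W" using * assms by auto
  show "even (crossings (us @ concat (replicate n [s, t]) @ vs) r) = even (crossings (us @ vs) r)"
    using even_crossings_relator[OF *(1,2) q rel] * word q assms(4) rel
    by (simp add: crossings_append)
qed

text \<open>If \<open>r = u s u\<inverse>\<close> with a prefix \<open>u\<close> of the word and the letter \<open>s\<close> following it, then multiplication
  by \<open>r\<close> cancels this letter.\<close>

lemma delete_crossing:
  assumes "ws \<in> lists S" "r \<in> carrier W" "crossings ws r > 0"
  shows "\<exists>us s vs. ws = us @ s # vs \<and> r \<otimes> wp ws = wp (us @ vs)"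
  using assms
proof (induction ws arbitrary: r)
  case (Cons s ws)
  show ?case
  proof (cases "r = s")
    case True
    have "s # ws = [] @ s # ws \<and> r \<otimes> wp (s # ws) = wp ([] @ ws)"
      using Cons.hyps by (simp add: True)
    then show ?thesis by blast
  next
    case False
    then obtain us t vs where *: "ws = us @ t # vs" "s \<otimes> r \<otimes> s \<otimes> wp ws = wp (us @ vs)"
      using Cons.IH[of "s \<otimes> r \<otimes> s"] Cons.hyps Cons.prems by auto
    have "r \<otimes> wp (s # ws) = s \<otimes> (s \<otimes> r \<otimes> s \<otimes> wp ws)"
      using Cons.hyps Cons.prems by (simp add: m_assoc)
    then show ?thesis using * by (intro exI[of _ "s # us"] exI[of _ t] exI[of _ vs]) simp
  qed
qed simp

text \<open>The words \<open>ws\<close> and \<open>s # ws\<close> cross the wall of \<open>s\<close> with different parities. Were there no crossing in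
  \<open>ws\<close>, every word of \<open>s \<otimes> wp ws\<close> would cross that wall, and deleting the crossing from a reduced word
  would make \<open>wp ws\<close> shorter than \<open>s \<otimes> wp ws\<close>.\<close>

lemma exchange:
  assumes "ws \<in> lists S" "s \<in> S" "len (s \<otimes> wp ws) < len (wp ws)"
  shows "\<exists>us t vs. ws = us @ t # vs \<and> s \<otimes> wp ws = wp (us @ vs)"
proof (rule delete_crossing)
  show "crossings ws s > 0"
  proof (rule ccontr)
    assume "\<not> crossings ws s > 0"
    then have one: "crossings (s # ws) s = 1" using assms by simp
    obtain vs where vs: "reduced vs" "wp vs = wp (s # ws)"
      using ex_reduced[of "wp (s # ws)"] assms by auto
    have "odd (crossings vs s)"
      using even_crossings_cong[of vs "s # ws" s] one vs assms by (auto simp: reduced_def)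
    then have "crossings vs s > 0" by (auto intro: gr0I)
    then obtain as t bs where *: "vs = as @ t # bs" "s \<otimes> wp vs = wp (as @ bs)"
      using delete_crossing[of vs s] vs assms by (auto simp: reduced_def)
    have "len (wp ws) < length vs"
      using len_le_length[of "as @ bs"] * vs assms by (auto simp: reduced_def)
    then show False using vs assms by (simp add: reduced_def)
  qed
qed (use assms in auto)

text \<open>The length refers to all of \<open>S\<close>. Since the exchange condition shortens a word by deleting letters,
  a reduced word can be found inside any given word and hence inside the alphabet \<open>I\<close>.\<close>

lemma ex_reduced_parabolic:
  assumes "I \<subseteq> S" "x \<in> generate W I"
  shows "\<exists>ws\<in>lists I. reduced ws \<and> wp ws = x"
proof -
  obtain ws where "ws \<in> lists I" "wp ws = x" using generate_iff_word assms by blast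
  then show ?thesis
  proof (induction ws arbitrary: x)
    case Nil
    then show ?case by (intro bexI[of _ "[]"]) (auto simp: reduced_def)
  next
    case (Cons s ws)
    then obtain vs where vs: "vs \<in> lists I" "reduced vs" "wp vs = wp ws" by auto
    have s: "s \<in> I" "s \<in> S" using Cons assms by auto
    have vsS: "vs \<in> lists S" using vs by (simp add: reduced_def)
    show ?case
    proof (cases "len (s \<otimes> wp vs) < len (wp vs)")
      case True
      then obtain as t bs where *: "vs = as @ t # bs" "s \<otimes> wp vs = wp (as @ bs)"
        using exchange[OF vsS s(2)] by blast
      have "length (as @ bs) = len (wp (as @ bs))"
        using len_gen_mult[OF s(2) wp_closed[OF vsS]] len_le_length[of "as @ bs"] True vs * vsS
        by (auto simp: reduced_def)
      then show ?thesis using * vs vsS Cons.prems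
        by (intro bexI[of _ "as @ bs"]) (auto simp: reduced_def)
    next
      case False
      then have "len (s \<otimes> wp vs) = Suc (len (wp vs))"
        using len_gen_mult[OF s(2), of "wp vs"] vsS by auto
      then show ?thesis using vs s vsS Cons.prems
        by (intro bexI[of _ "s # vs"]) (auto simp: reduced_def)
    qed
  qed
qed

text \<open>The condition that \<open>s\<close> increases the length of \<open>v\<close> says that \<open>s \<otimes> v\<close> is also the product in the
  Coxeter monoid. Thus statements about that product can be proved along words in the group.\<close>

lemma parabolic_induct [consumes 2, case_names one mult]:
  assumes "I \<subseteq> S" "x \<in> generate W I"
    and one: "P \<one>"
    and mult: "\<And>s v. \<lbrakk>s \<in> I; v \<in> generate W I; len v < len (s \<otimes> v); P v\<rbrakk> \<Longrightarrow> P (s \<otimes> v)"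
  shows "P x"
proof -
  obtain ws where "ws \<in> lists I" "reduced ws" "wp ws = x"
    using ex_reduced_parabolic assms(1,2) by blast
  then show ?thesis
  proof (induction ws arbitrary: x)
    case (Cons s ws)
    then show ?case
      using reduced_ConsD[of s ws] generate_iff_word[OF assms(1)] by (auto intro!: mult)
  qed (use one in auto)
qed

section \<open>The Coxeter monoid\<close>

definition up_left :: "'a \<Rightarrow> 'a \<Rightarrow> 'a" where
  "up_left s x = (if len x < len (s \<otimes> x) then s \<otimes> x else x)"

definition up_right :: "'a \<Rightarrow> 'a \<Rightarrow> 'a" where
  "up_right x s = (if len x < len (x \<otimes> s) then x \<otimes> s else x)"

lemma up_closed [simp]:
  "\<lbrakk>s \<in> S; x \<in> carrier W\<rbrakk> \<Longrightarrow> up_left s x \<in> carrier W"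
  "\<lbrakk>s \<in> S; x \<in> carrier W\<rbrakk> \<Longrightarrow> up_right x s \<in> carrier W"
  by (auto simp: up_left_def up_right_def)

text \<open>Exchange in a reduced word of \<open>x\<close> followed by \<open>t\<close>: a letter inside the word of \<open>x\<close> cannot be
  deleted, because this would make \<open>s \<otimes> x\<close> shorter than \<open>x\<close>. So the letter \<open>t\<close> is deleted.\<close>

lemma gen_mult_eq_mult_gen:
  assumes "s \<in> S" "t \<in> S" "x \<in> carrier W"
    and "len x < len (s \<otimes> x)" "len x < len (x \<otimes> t)" "len (s \<otimes> x \<otimes> t) < len (x \<otimes> t)"
  shows "s \<otimes> x = x \<otimes> t"
proof -
  obtain ws where ws: "reduced ws" "wp ws = x" using ex_reduced assms by blast
  have wsS: "ws \<in> lists S" using ws by (simp add: reduced_def)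
  have wst: "wp (ws @ [t]) = x \<otimes> t" using wsS ws assms by (simp add: wp_append)
  obtain us r vs where *: "ws @ [t] = us @ r # vs" "s \<otimes> (x \<otimes> t) = wp (us @ vs)"
    using exchange[of "ws @ [t]" s] assms wst wsS by (auto simp: m_assoc)
  show ?thesis
  proof (cases vs rule: rev_cases)
    case Nil
    then have "s \<otimes> (x \<otimes> t) = x" using * ws by simp
    then show ?thesis using gen_cancel[of s "x \<otimes> t"] assms by simp
  next
    case (snoc vs' r')
    then have **: "ws = us @ r # vs'" "r' = t" using * by auto
    then have "s \<otimes> x \<otimes> t = wp (us @ vs') \<otimes> t"
      using *(2) snoc wsS assms by (auto simp: wp_append m_assoc)
    then have "s \<otimes> x = wp (us @ vs')" using ** wsS assms by auto
    then have "len (s \<otimes> x) < len x"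
      using len_le_length[of "us @ vs'"] ** wsS ws by (auto simp: reduced_def)
    then show ?thesis using assms by simp
  qed
qed

text \<open>The only configuration in which the two sides could differ is that \<open>s\<close> and \<open>t\<close> each increase \<open>x\<close>
  while applying both does not increase further; then \<open>s \<otimes> x = x \<otimes> t\<close>.\<close>

lemma up_left_up_right:
  assumes "s \<in> S" "t \<in> S" "x \<in> carrier W"
  shows "up_left s (up_right x t) = up_right (up_left s x) t"
proof -
  have assoc: "s \<otimes> (x \<otimes> t) = s \<otimes> x \<otimes> t" using assms by (simp add: m_assoc)
  have left: "len (s \<otimes> x) = Suc (len x) \<or> len x = Suc (len (s \<otimes> x))"
    "len (s \<otimes> x \<otimes> t) = Suc (len (x \<otimes> t)) \<or> len (x \<otimes> t) = Suc (len (s \<otimes> x \<otimes> t))"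
    using len_gen_mult[of s x] len_gen_mult[of s "x \<otimes> t"] assms by (simp_all add: assoc)
  have right: "len (x \<otimes> t) = Suc (len x) \<or> len x = Suc (len (x \<otimes> t))"
    "len (s \<otimes> x \<otimes> t) = Suc (len (s \<otimes> x)) \<or> len (s \<otimes> x) = Suc (len (s \<otimes> x \<otimes> t))"
    using len_mult_gen[of t x] len_mult_gen[of t "s \<otimes> x"] assms by simp_all
  show ?thesis
  proof (cases "len x < len (s \<otimes> x) \<and> len x < len (x \<otimes> t)")
    case True
    then have lens: "len (s \<otimes> x) = Suc (len x)" "len (x \<otimes> t) = Suc (len x)"
      using left(1) right(1) by linarith+
    show ?thesis
    proof (cases "len (s \<otimes> x \<otimes> t) < len (x \<otimes> t)")
      case True
      then have "s \<otimes> x = x \<otimes> t" using gen_mult_eq_mult_gen[OF assms] lens by simp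
      then show ?thesis using True lens by (simp add: up_left_def up_right_def assoc)
    next
      case False
      then have "len (s \<otimes> x \<otimes> t) = Suc (Suc (len x))" using left(2) lens by linarith
      then show ?thesis using lens by (simp add: up_left_def up_right_def assoc)
    qed
  next
    case False
    then show ?thesis
      using left right by (auto simp: up_left_def up_right_def assoc)
  qed
qed

lemma foldr_up_left_closed [simp]:
  "\<lbrakk>ws \<in> lists S; x \<in> carrier W\<rbrakk> \<Longrightarrow> foldr up_left ws x \<in> carrier W"
  by (induction ws) auto

lemma foldl_up_right_closed [simp]:
  "\<lbrakk>ws \<in> lists S; x \<in> carrier W\<rbrakk> \<Longrightarrow> foldl up_right x ws \<in> carrier W"
  by (induction ws arbitrary: x) auto

lemma foldr_up_left_reduced: "reduced ws \<Longrightarrow> foldr up_left ws \<one> = wp ws"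
proof (induction ws)
  case (Cons s ws)
  then show ?case using reduced_ConsD[OF Cons.prems] by (simp add: up_left_def)
qed simp

lemma foldl_up_right_reduced: "reduced ws \<Longrightarrow> foldl up_right \<one> ws = wp ws"
proof (induction ws rule: rev_induct)
  case (snoc s ws)
  then show ?case using reduced_snocD[OF snoc.prems]
    by (auto simp: up_right_def wp_append reduced_def)
qed simp

lemma foldr_up_left_foldl_up_right:
  assumes "us \<in> lists S" "vs \<in> lists S" "x \<in> carrier W"
  shows "foldr up_left us (foldl up_right x vs) = foldl up_right (foldr up_left us x) vs"
proof -
  have one: "foldr up_left us (up_right y t) = up_right (foldr up_left us y) t"
    if "t \<in> S" "y \<in> carrier W" for y t
    using assms(1) that by (induction us) (auto simp: up_left_up_right)
  show ?thesis
    using assms(2,3) by (induction vs arbitrary: x) (auto simp: one)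
qed

lemma foldr_up_left_cases:
  assumes "ws \<in> lists S" "x \<in> carrier W"
  shows "foldr up_left ws x = x \<or> len x < len (foldr up_left ws x)"
  using assms by (induction ws) (auto simp: up_left_def)

lemma foldl_up_right_cases:
  assumes "ws \<in> lists S" "x \<in> carrier W"
  shows "foldl up_right x ws = x \<or> len x < len (foldl up_right x ws)"
  using assms by (induction ws rule: rev_induct) (auto simp: up_right_def)

text \<open>A reduced word is chosen to define the product; by \<open>demazure_foldr\<close> and \<open>demazure_foldl\<close> below the
  value does not depend on the choice.\<close>

definition red :: "'a \<Rightarrow> 'a list" where
  "red x = (SOME ws. reduced ws \<and> wp ws = x)"

lemma red:
  assumes "x \<in> carrier W" shows "reduced (red x)" "wp (red x) = x" "red x \<in> lists S"
  using someI_ex[OF ex_reduced[OF assms]] unfolding red_def by (auto simp: reduced_def)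

definition demazure :: "'a \<Rightarrow> 'a \<Rightarrow> 'a" (infixl "\<star>" 70) where
  "x \<star> y = (if x \<in> carrier W \<and> y \<in> carrier W then foldr up_left (red x) y else undefined)"

lemma demazure_closed [simp]: "\<lbrakk>x \<in> carrier W; y \<in> carrier W\<rbrakk> \<Longrightarrow> x \<star> y \<in> carrier W"
  by (simp add: demazure_def red del: in_lists_conv_set)

text \<open>Writing \<open>x\<close> as a composite of left steps applied to \<open>\<one>\<close> and moving these past the right steps shows
  that the composite of right steps along \<open>ws\<close> sends \<open>x\<close> to a value that depends only on \<open>x\<close> and on the
  image of \<open>\<one>\<close>.\<close>

lemma demazure_foldl:
  assumes "x \<in> carrier W" "ws \<in> lists S"
  shows "x \<star> foldl up_right \<one> ws = foldl up_right x ws"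
  using assms red[OF assms(1)]
  by (simp add: demazure_def foldr_up_left_foldl_up_right foldr_up_left_reduced)

lemma demazure_eq_foldl:
  assumes "x \<in> carrier W" "y \<in> carrier W"
  shows "x \<star> y = foldl up_right x (red y)"
  using demazure_foldl[OF assms(1), of "red y"] red[OF assms(2)]
  by (simp add: foldl_up_right_reduced)

lemma demazure_foldr:
  assumes "y \<in> carrier W" "ws \<in> lists S"
  shows "foldr up_left ws \<one> \<star> y = foldr up_left ws y"
  using assms red[OF assms(1)]
  by (simp add: demazure_eq_foldl foldr_up_left_foldl_up_right[symmetric] foldl_up_right_reduced)

text \<open>Multiplication by \<open>x\<close> on the left is a composite of left steps and multiplication by \<open>z\<close> on the
  right is a composite of right steps, and these commute.\<close>

lemma demazure_assoc:
  assumes "x \<in> carrier W" "y \<in> carrier W" "z \<in> carrier W"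
  shows "x \<star> y \<star> z = x \<star> (y \<star> z)"
proof -
  have "x \<star> y \<star> z = foldl up_right (foldr up_left (red x) y) (red z)"
    using assms by (simp add: demazure_eq_foldl[of _ z]) (simp add: demazure_def)
  also have "\<dots> = foldr up_left (red x) (foldl up_right y (red z))"
    using assms by (simp add: foldr_up_left_foldl_up_right red del: in_lists_conv_set)
  also have "\<dots> = x \<star> (y \<star> z)"
    using assms by (simp add: demazure_eq_foldl[of y z]) (simp add: demazure_def red del: in_lists_conv_set)
  finally show ?thesis .
qed

lemma demazure_one [simp]:
  assumes "x \<in> carrier W" shows "x \<star> \<one> = x" "\<one> \<star> x = x"
  using demazure_foldl[of x "[]"] demazure_foldr[of x "[]"] assms by auto

lemma demazure_gen [simp]:
  assumes "s \<in> S" "x \<in> carrier W" shows "s \<star> x = up_left s x" "x \<star> s = up_right x s"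
proof -
  have "\<one> \<noteq> s" using len_gen_mult[of s \<one>] assms by auto
  moreover have "len s \<noteq> 0" using len_gen_mult[of s \<one>] assms by auto
  ultimately have "up_left s \<one> = s" "up_right \<one> s = s"
    using assms by (auto simp: up_left_def up_right_def)
  then show "s \<star> x = up_left s x" "x \<star> s = up_right x s"
    using demazure_foldr[of x "[s]"] demazure_foldl[of x "[s]"] assms by auto
qed

text \<open>Each step either fixes its argument or makes it longer, and the product is a composite of left
  steps applied to \<open>y\<close> as well as a composite of right steps applied to \<open>x\<close>.\<close>

lemma demazure_cases:
  assumes "x \<in> carrier W" "y \<in> carrier W"
  shows "x \<star> y = y \<or> len y < len (x \<star> y)" "x \<star> y = x \<or> len x < len (x \<star> y)"
proof -
  show "x \<star> y = y \<or> len y < len (x \<star> y)"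
    using foldr_up_left_cases[OF red(3)[OF assms(1)] assms(2)] assms by (simp add: demazure_def)
  show "x \<star> y = x \<or> len x < len (x \<star> y)"
    using foldl_up_right_cases[OF red(3)[OF assms(2)] assms(1)] assms
    by (simp add: demazure_eq_foldl)
qed

lemma bruhat_less_imp_len:
  assumes "bruhat_less W S x y" shows "len x < len y"
proof -
  have "(bruhat_step W S)\<^sup>*\<^sup>* x y" "x \<noteq> y"
    using assms by (auto simp: bruhat_less_def bruhat_le_def)
  then have "(bruhat_step W S)\<^sup>+\<^sup>+ x y" by (meson rtranclpD)
  then show ?thesis by (induction rule: tranclp_induct) (auto simp: bruhat_step_def)
qed

lemma bruhat_less_mult_gen:
  assumes "s \<in> S" "x \<in> carrier W"
  shows "bruhat_less W S x (x \<otimes> s) \<longleftrightarrow> len x < len (x \<otimes> s)"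
    and "bruhat_less W S (x \<otimes> s) x \<longleftrightarrow> len (x \<otimes> s) < len x"
proof -
  have "\<one> \<otimes> s \<otimes> inv \<one> \<in> reflections W S"
    unfolding reflections_def using assms by blast
  then have s: "s \<in> reflections W S" using assms by simp
  have less: "bruhat_less W S y (y \<otimes> s)" if "y \<in> carrier W" "len y < len (y \<otimes> s)" for y
  proof -
    have "bruhat_step W S y (y \<otimes> s)" using that s by (auto simp: bruhat_step_def)
    then show ?thesis using that by (auto simp: bruhat_less_def bruhat_le_def)
  qed
  show "bruhat_less W S x (x \<otimes> s) \<longleftrightarrow> len x < len (x \<otimes> s)"
    using less[of x] bruhat_less_imp_len assms by auto
  show "bruhat_less W S (x \<otimes> s) x \<longleftrightarrow> len (x \<otimes> s) < len x"
    using less[of "x \<otimes> s"] bruhat_less_imp_len assms by auto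
qed

text \<open>Left multiplication by \<open>s\<close> is right multiplication by the reflection \<open>x\<inverse> s x\<close>.\<close>

lemma bruhat_less_gen_mult:
  assumes "s \<in> S" "x \<in> carrier W" "len x < len (s \<otimes> x)"
  shows "bruhat_less W S x (s \<otimes> x)"
proof -
  have "inv x \<otimes> s \<otimes> inv (inv x) \<in> reflections W S"
    unfolding reflections_def using assms by blast
  moreover have "s \<otimes> x = x \<otimes> (inv x \<otimes> s \<otimes> inv (inv x))"
    using assms by (simp add: m_assoc[symmetric])
  ultimately have "bruhat_step W S x (s \<otimes> x)"
    unfolding bruhat_step_def using assms by blast
  then show ?thesis using assms by (auto simp: bruhat_less_def bruhat_le_def)
qed

lemma demazure_is_coxeter_product: "is_coxeter_product W S (\<star>)"
proof -
  have "monoid (W\<lparr>mult := (\<star>)\<rparr>)"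
    by (rule monoidI) (auto simp: demazure_assoc)
  moreover have "(bruhat_less W S x (x \<otimes> s) \<longrightarrow> x \<star> s = x \<otimes> s) \<and>
      (bruhat_less W S (x \<otimes> s) x \<longrightarrow> x \<star> s = x)"
    if "x \<in> carrier W" "s \<in> S" for x s
    using that by (auto simp: bruhat_less_mult_gen up_right_def)
  moreover have "x \<star> y = undefined" if "x \<notin> carrier W \<or> y \<notin> carrier W" for x y
    using that by (auto simp: demazure_def)
  ultimately show ?thesis unfolding is_coxeter_product_def by blast
qed

text \<open>The value of \<open>f x\<close> at a reduced word is forced one letter at a time by associativity.\<close>

lemma coxeter_product_unique:
  assumes "is_coxeter_product W S f"
  shows "f = (\<star>)"
proof (intro ext)
  fix x y
  interpret f: monoid "W\<lparr>mult := f\<rparr>" using assms by (simp add: is_coxeter_product_def)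
  have closed: "f u v \<in> carrier W" if "u \<in> carrier W" "v \<in> carrier W" for u v
    using f.m_closed that by simp
  have assoc: "f (f u v) w = f u (f v w)"
    if "u \<in> carrier W" "v \<in> carrier W" "w \<in> carrier W" for u v w
    using f.m_assoc that by simp
  have one: "f u \<one> = u" if "u \<in> carrier W" for u
    using f.r_one that by simp
  have gen: "f u s = up_right u s" if "u \<in> carrier W" "s \<in> S" for u s
    using assms that len_mult_gen[of s u]
    by (auto simp: is_coxeter_product_def bruhat_less_mult_gen up_right_def)
  have *: "f x (foldl up_right \<one> ws) = foldl up_right x ws"
    if "ws \<in> lists S" "x \<in> carrier W" for ws
    using that(1)
  proof (induction ws rule: rev_induct)
    case (snoc s ws)
    then show ?case using that(2) assoc[of x "foldl up_right \<one> ws" s]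
      by (simp add: gen[symmetric] closed)
  qed (simp add: one that)
  show "f x y = x \<star> y"
  proof (cases "x \<in> carrier W \<and> y \<in> carrier W")
    case True
    then show ?thesis
      using *[of "red y"] red[of y] by (simp add: foldl_up_right_reduced demazure_eq_foldl)
  next
    case False
    then show ?thesis using assms by (auto simp: is_coxeter_product_def demazure_def)
  qed
qed

lemma coxeter_monoid_eq: "coxeter_monoid W S = W\<lparr>mult := (\<star>)\<rparr>"
proof -
  have "(THE f. is_coxeter_product W S f) = (\<star>)"
    using demazure_is_coxeter_product coxeter_product_unique by (rule the_equality)
  then show ?thesis by (simp add: coxeter_monoid_def)
qed

section \<open>Longest elements and idempotents\<close>

lemma parabolic_closed [simp]: "\<lbrakk>I \<subseteq> S; x \<in> generate W I\<rbrakk> \<Longrightarrow> x \<in> carrier W"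
  using generate_in_carrier[of I x] S_closed by (meson subset_iff)

lemma parabolic_demazure_absorb:
  assumes "I \<subseteq> S" "v \<in> generate W I" "w \<in> carrier W"
  shows "(\<And>s. s \<in> I \<Longrightarrow> s \<star> w = w) \<Longrightarrow> v \<star> w = w"
    and "(\<And>s. s \<in> I \<Longrightarrow> w \<star> s = w) \<Longrightarrow> w \<star> v = w"
proof -
  have step: "s \<in> S" "v \<in> carrier W" "s \<otimes> v = s \<star> v"
    if "s \<in> I" "v \<in> generate W I" "len v < len (s \<otimes> v)" for s v
  proof -
    show "s \<in> S" "v \<in> carrier W" using that assms(1) by auto
    then show "s \<otimes> v = s \<star> v" using that by (simp add: up_left_def)
  qed
  show "v \<star> w = w" if "\<And>s. s \<in> I \<Longrightarrow> s \<star> w = w"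
    using assms(1,2)
  proof (induction rule: parabolic_induct)
    case (mult s v)
    show ?case unfolding step(3)[OF mult(1-3)]
      using step(1,2)[OF mult(1-3)] mult that assms
      by (simp add: demazure_assoc del: demazure_gen)
  qed (simp add: assms)
  show "w \<star> v = w" if "\<And>s. s \<in> I \<Longrightarrow> w \<star> s = w"
    using assms(1,2)
  proof (induction rule: parabolic_induct)
    case (mult s v)
    show ?case unfolding step(3)[OF mult(1-3)]
      using step(1,2)[OF mult(1-3)] mult that assms
      by (simp add: demazure_assoc[symmetric] del: demazure_gen)
  qed (simp add: assms)
qed

text \<open>An element \<open>w\<close> that cannot be increased by any generator in \<open>I\<close> satisfies \<open>v \<star> w = w\<close> for all \<open>v \<in> W\<^sub>I\<close>.
  But \<open>v \<star> w\<close> also arises from \<open>v\<close> by right steps, so it is \<open>v\<close> or longer than \<open>v\<close>. The bound on the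
  lengths is stated separately because it yields finiteness of \<open>W\<^sub>I\<close> for idempotents.\<close>

lemma longest_elt_eqI:
  assumes I: "I \<subseteq> S" and w: "w \<in> generate W I" and desc: "\<And>s. s \<in> I \<Longrightarrow> s \<star> w = w"
  shows "longest_elt W S I = w" "\<And>v. v \<in> generate W I \<Longrightarrow> len v \<le> len w"
proof -
  have wc: "w \<in> carrier W" using I w by simp
  have abs: "v \<star> w = w" if "v \<in> generate W I" for v
    using parabolic_demazure_absorb(1)[OF I that wc] desc by blast
  show le: "len v \<le> len w" if "v \<in> generate W I" for v
  proof -
    have "v \<in> carrier W" using that I by simp
    then show ?thesis using demazure_cases(2)[of v w] abs[OF that] wc by auto
  qed
  have "v = w" if v: "v \<in> generate W I" "\<forall>u\<in>generate W I. len u \<le> len v" for v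
  proof -
    have "v \<in> carrier W" "len w \<le> len v" using v w I by auto
    then show ?thesis using demazure_cases(2)[of v w] abs[OF v(1)] wc by auto
  qed
  then show "longest_elt W S I = w"
    unfolding longest_elt_def using w le by (intro the_equality) blast+
qed

lemma longest_elt:
  assumes "finitary W S I"
  shows "longest_elt W S I \<in> generate W I"
    and "\<And>s. s \<in> I \<Longrightarrow> s \<star> longest_elt W S I = longest_elt W S I"
    and "\<And>s. s \<in> I \<Longrightarrow> longest_elt W S I \<star> s = longest_elt W S I"
proof -
  have I: "I \<subseteq> S" "finite (generate W I)" using assms by (auto simp: finitary_def)
  have "len ` generate W I \<noteq> {}" using generate.one[of W I] by blast
  then have "Max (len ` generate W I) \<in> len ` generate W I" using I by (intro Max_in) auto
  then obtain w where w: "w \<in> generate W I" "len w = Max (len ` generate W I)" by auto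
  have max: "len v \<le> len w" if "v \<in> generate W I" for v
    using that I w by simp
  have wc: "w \<in> carrier W" using w(1) I by simp
  have left: "s \<star> w = w" and right: "w \<star> s = w" if s: "s \<in> I" for s
  proof -
    have "len (s \<otimes> w) \<le> len w" "len (w \<otimes> s) \<le> len w"
      using max[OF generate.eng[OF generate.incl[OF s] w(1)]]
        max[OF generate.eng[OF w(1) generate.incl[OF s]]] by simp_all
    then show "s \<star> w = w" "w \<star> s = w"
      using s I wc by (auto simp: up_left_def up_right_def subset_iff)
  qed
  have "longest_elt W S I = w" using longest_elt_eqI(1)[OF I(1) w(1) left] .
  then show "longest_elt W S I \<in> generate W I"
    "\<And>s. s \<in> I \<Longrightarrow> s \<star> longest_elt W S I = longest_elt W S I"
    "\<And>s. s \<in> I \<Longrightarrow> longest_elt W S I \<star> s = longest_elt W S I"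
    using w(1) left right by auto
qed

lemma longest_elt_closed [simp]: "finitary W S I \<Longrightarrow> longest_elt W S I \<in> carrier W"
  using longest_elt(1)[of I] parabolic_closed[of I] by (auto simp: finitary_def)

lemma longest_elt_idem:
  assumes "finitary W S I" shows "longest_elt W S I \<star> longest_elt W S I = longest_elt W S I"
proof -
  have I: "I \<subseteq> S" using assms by (simp add: finitary_def)
  show ?thesis
    using parabolic_demazure_absorb(1)[OF I longest_elt(1)[OF assms] longest_elt_closed[OF assms]]
      longest_elt(2)[OF assms] by blast
qed

text \<open>Steps never decrease the length, so a composite of steps can fix \<open>w\<close> only if each of them does.\<close>

lemma foldr_up_left_fixed:
  assumes "ws \<in> lists S" "w \<in> carrier W" "foldr up_left ws w = w" "s \<in> set ws"
  shows "up_left s w = w"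
  using assms
proof (induction ws)
  case (Cons t ws)
  have ws: "t \<in> S" "ws \<in> lists S" using Cons.hyps by auto
  let ?x = "foldr up_left ws w"
  have up: "up_left t ?x = w" using Cons.prems by simp
  then have "len ?x \<le> len w" by (auto simp: up_left_def split: if_splits)
  then have x: "?x = w" using foldr_up_left_cases[OF ws(2)] Cons.prems by fastforce
  then have "up_left t w = w" using up by simp
  then show ?case using Cons.IH Cons.prems x by auto
qed simp

lemma idempotent_is_longest:
  assumes w: "w \<in> carrier W" and idem: "w \<star> w = w"
  shows "\<exists>I. finitary W S I \<and> longest_elt W S I = w"
proof (intro exI conjI)
  let ?I = "set (red w)"
  have I: "?I \<subseteq> S" using red(3)[OF w] by auto
  have gen: "w \<in> generate W ?I"
    using generate_iff_word[OF I, of w] red(2)[OF w] by auto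
  have desc: "s \<star> w = w" if "s \<in> ?I" for s
  proof -
    have "foldr up_left (red w) w = w" using idem w by (simp add: demazure_def)
    then have "up_left s w = w" using foldr_up_left_fixed[OF red(3)[OF w] w] that by blast
    then show ?thesis using that I w by auto
  qed
  show "longest_elt W S ?I = w" using longest_elt_eqI(1)[OF I gen desc] .
  have "generate W ?I \<subseteq> wp ` {ws. set ws \<subseteq> ?I \<and> length ws \<le> len w}"
  proof
    fix v assume v: "v \<in> generate W ?I"
    obtain ws where "ws \<in> lists ?I" "reduced ws" "wp ws = v"
      using ex_reduced_parabolic[OF I v] by blast
    moreover have "len v \<le> len w" using longest_elt_eqI(2)[OF I gen desc v] .
    ultimately show "v \<in> wp ` {ws. set ws \<subseteq> ?I \<and> length ws \<le> len w}"
      by (auto simp: reduced_def)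
  qed
  then have "finite (generate W ?I)"
    by (rule finite_subset) (auto intro: finite_lists_length_le)
  then show "finitary W S ?I" using I by (simp add: finitary_def)
qed

section \<open>Maximal elements of double cosets\<close>

lemma double_coset_iff:
  "y \<in> double_coset W J x I \<longleftrightarrow> (\<exists>a\<in>generate W J. \<exists>b\<in>generate W I. y = a \<otimes> x \<otimes> b)"
  by (auto simp: double_coset_def r_coset_def set_mult_def)

lemma double_coset_eq:
  assumes "J \<subseteq> S" "I \<subseteq> S" "x \<in> carrier W" "y \<in> double_coset W J x I"
  shows "double_coset W J y I = double_coset W J x I"
proof -
  have sub: "double_coset W J v I \<subseteq> double_coset W J u I"
    if u: "u \<in> carrier W" and v: "v \<in> double_coset W J u I" for u v
  proof
    fix z assume "z \<in> double_coset W J v I"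
    then obtain a b c d where *: "a \<in> generate W J" "b \<in> generate W I" "v = a \<otimes> u \<otimes> b"
      "c \<in> generate W J" "d \<in> generate W I" "z = c \<otimes> v \<otimes> d"
      using v by (auto simp: double_coset_iff)
    have "z = (c \<otimes> a) \<otimes> u \<otimes> (b \<otimes> d)" using * u assms by (simp add: m_assoc)
    then show "z \<in> double_coset W J u I"
      unfolding double_coset_iff using generate.eng[OF *(4,1)] generate.eng[OF *(2,5)] by blast
  qed
  obtain a b where *: "a \<in> generate W J" "b \<in> generate W I" "y = a \<otimes> x \<otimes> b"
    using assms by (auto simp: double_coset_iff)
  have c: "a \<in> carrier W" "b \<in> carrier W" using parabolic_closed *(1,2) assms(1,2) by blast+
  have "inv a \<otimes> y \<otimes> inv b = inv a \<otimes> (a \<otimes> x)"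
    using c assms(3) *(3) by (simp add: m_assoc)
  also have "\<dots> = x" using c assms(3) by (simp add: m_assoc[symmetric])
  finally have x: "x = inv a \<otimes> y \<otimes> inv b" ..
  have "I \<subseteq> carrier W" "J \<subseteq> carrier W" using assms S_closed by blast+
  then have "inv a \<in> generate W J" "inv b \<in> generate W I"
    using generate_m_inv_closed *(1,2) by blast+
  then have "x \<in> double_coset W J y I" unfolding double_coset_iff using x by blast
  moreover have "y \<in> carrier W" using * c assms by simp
  ultimately show ?thesis using sub[of x y] sub[of y x] assms(3,4) by blast
qed

lemma double_coset_closed:
  "\<lbrakk>J \<subseteq> S; I \<subseteq> S; x \<in> carrier W; y \<in> double_coset W J x I\<rbrakk> \<Longrightarrow> y \<in> carrier W"
  by (auto simp: double_coset_iff)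

lemma parabolic_demazure_left:
  assumes "J \<subseteq> S" "a \<in> generate W J" "x \<in> carrier W"
  shows "\<exists>c\<in>generate W J. a \<star> x = c \<otimes> x"
  using assms(1,2)
proof (induction rule: parabolic_induct)
  case one
  show ?case using assms by (intro bexI[of _ "\<one>"]) (auto intro: generate.one)
next
  case (mult s v)
  then obtain c where c: "c \<in> generate W J" "v \<star> x = c \<otimes> x" by blast
  have s: "s \<in> S" and v: "v \<in> carrier W" using mult assms by auto
  have "(s \<otimes> v) \<star> x = s \<star> (v \<star> x)"
    using demazure_assoc[of s v x] s v mult assms by (simp add: up_left_def)
  then have "(s \<otimes> v) \<star> x = c \<otimes> x \<or> (s \<otimes> v) \<star> x = (s \<otimes> c) \<otimes> x"
    using c s assms by (auto simp: up_left_def m_assoc)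
  moreover have "s \<otimes> c \<in> generate W J"
    using generate.eng[OF generate.incl[OF mult.hyps(1)] c(1)] .
  ultimately show ?case using c by blast
qed

lemma parabolic_demazure_right:
  assumes "I \<subseteq> S" "b \<in> generate W I" "x \<in> carrier W"
  shows "\<exists>c\<in>generate W I. x \<star> b = x \<otimes> c"
  using assms
proof (induction arbitrary: x rule: parabolic_induct)
  case one
  then show ?case by (intro bexI[of _ "\<one>"]) (auto intro: generate.one)
next
  case (mult s v)
  have s: "s \<in> S" and v: "v \<in> carrier W" using mult assms by auto
  have eq: "x \<star> (s \<otimes> v) = up_right x s \<star> v"
    using demazure_assoc[of x s v] s v mult by (simp add: up_left_def)
  obtain c where "c \<in> generate W I" "up_right x s \<star> v = up_right x s \<otimes> c"
    using mult.IH[of "up_right x s"] up_closed(2)[OF s mult.prems] by blast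
  moreover from this have "up_right x s \<otimes> c = x \<otimes> c \<or> up_right x s \<otimes> c = x \<otimes> (s \<otimes> c)"
    using s assms mult.prems by (auto simp: up_right_def m_assoc)
  moreover have "s \<otimes> c \<in> generate W I"
    using generate.eng[OF generate.incl[OF mult.hyps(1)] calculation(1)] .
  ultimately show ?case unfolding eq by auto
qed

text \<open>A step from \<open>y\<close> to \<open>s \<otimes> y\<close> with \<open>s \<in> J\<close> goes up or down; in either case the longer of the two elements is
  \<open>s \<star>\<close> the shorter one, and \<open>w\<^sub>J\<close> absorbs \<open>s\<close>.\<close>

lemma longest_demazure_mult:
  assumes "finitary W S J" "a \<in> generate W J" "x \<in> carrier W"
  shows "longest_elt W S J \<star> (a \<otimes> x) = longest_elt W S J \<star> x"
proof -
  let ?w = "longest_elt W S J"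
  have J: "J \<subseteq> S" using assms by (simp add: finitary_def)
  have step: "?w \<star> (s \<otimes> y) = ?w \<star> y" if "s \<in> J" and y: "y \<in> carrier W" for s y
  proof -
    have s: "s \<in> S" using that J by auto
    have absorb: "?w \<star> (s \<star> z) = ?w \<star> z" if "z \<in> carrier W" for z
      using demazure_assoc[of ?w s z] longest_elt(3)[OF assms(1) \<open>s \<in> J\<close>] s that assms(1)
      by (simp del: demazure_gen)
    show ?thesis
    proof (cases "len y < len (s \<otimes> y)")
      case True
      then have "s \<star> y = s \<otimes> y" using s y by (simp add: up_left_def)
      then show ?thesis using absorb[OF y] by simp
    next
      case False
      then have "s \<star> (s \<otimes> y) = y" using len_gen_mult[OF s y] s y by (simp add: up_left_def)
      then show ?thesis using absorb[of "s \<otimes> y"] s y by simp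
    qed
  qed
  show ?thesis
    using J assms(2)
  proof (induction rule: parabolic_induct)
    case (mult s v)
    then show ?case using step[of s "v \<otimes> x"] J assms(3) by (simp add: m_assoc subset_iff)
  qed (use assms in simp)
qed

lemma mult_demazure_longest:
  assumes "finitary W S I" "b \<in> generate W I" "x \<in> carrier W"
  shows "(x \<otimes> b) \<star> longest_elt W S I = x \<star> longest_elt W S I"
proof -
  let ?w = "longest_elt W S I"
  have I: "I \<subseteq> S" using assms by (simp add: finitary_def)
  have step: "(y \<otimes> s) \<star> ?w = y \<star> ?w" if "s \<in> I" and y: "y \<in> carrier W" for s y
  proof -
    have s: "s \<in> S" using that I by auto
    have absorb: "(z \<star> s) \<star> ?w = z \<star> ?w" if "z \<in> carrier W" for z
      using demazure_assoc[of z s ?w] longest_elt(2)[OF assms(1) \<open>s \<in> I\<close>] s that assms(1)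
      by (simp del: demazure_gen)
    show ?thesis
    proof (cases "len y < len (y \<otimes> s)")
      case True
      then have "y \<star> s = y \<otimes> s" using s y by (simp add: up_right_def)
      then show ?thesis using absorb[OF y] by simp
    next
      case False
      then have "(y \<otimes> s) \<star> s = y" using len_mult_gen[OF s y] s y by (simp add: up_right_def)
      then show ?thesis using absorb[of "y \<otimes> s"] s y by simp
    qed
  qed
  show ?thesis
    using I assms(2,3)
  proof (induction arbitrary: x rule: parabolic_induct)
    case (mult s v)
    then have c: "s \<in> carrier W" "v \<in> carrier W" using I by auto
    have "(x \<otimes> (s \<otimes> v)) \<star> ?w = ((x \<otimes> s) \<otimes> v) \<star> ?w" using c mult.prems by (simp add: m_assoc)
    also have "\<dots> = x \<star> ?w" using mult.IH[of "x \<otimes> s"] step[OF mult.hyps(1)] c mult.prems by simp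
    finally show ?case .
  qed simp
qed

lemma longest_demazure_longest_mem:
  assumes J: "finitary W S J" and I: "finitary W S I" and x: "x \<in> carrier W"
  shows "longest_elt W S J \<star> x \<star> longest_elt W S I \<in> double_coset W J x I"
proof -
  have sub: "J \<subseteq> S" "I \<subseteq> S" using J I by (auto simp: finitary_def)
  obtain a where a: "a \<in> generate W J" "longest_elt W S J \<star> x = a \<otimes> x"
    using parabolic_demazure_left[OF sub(1) longest_elt(1)[OF J] x] by blast
  have "a \<otimes> x \<in> carrier W" using parabolic_closed[OF sub(1) a(1)] x by simp
  then obtain b where "b \<in> generate W I" "a \<otimes> x \<star> longest_elt W S I = a \<otimes> x \<otimes> b"
    using parabolic_demazure_right[OF sub(2) longest_elt(1)[OF I]] by blast
  then show ?thesis unfolding double_coset_iff a(2) using a(1) by blast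
qed

lemma max_elt_double_coset:
  assumes J: "finitary W S J" and I: "finitary W S I" and x: "x \<in> carrier W"
  shows "max_elt W S (double_coset W J x I) = longest_elt W S J \<star> x \<star> longest_elt W S I"
proof -
  let ?j = "longest_elt W S J" and ?i = "longest_elt W S I" and ?p = "double_coset W J x I"
  let ?m = "?j \<star> x \<star> ?i"
  have sub: "J \<subseteq> S" "I \<subseteq> S" using J I by (auto simp: finitary_def)
  have ij [simp]: "?i \<in> carrier W" "?j \<in> carrier W" using I J by auto
  \<comment> \<open>By constancy of \<open>w\<^sub>J \<star> y \<star> w\<^sub>I\<close> on the coset, each \<open>y\<close> in it is at most as long as this value. An
    element above it in the Bruhat order would be longer, so the value is maximal.\<close>
  have const: "?j \<star> y \<star> ?i = ?m" if y: "y \<in> ?p" for y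
  proof -
    obtain a b where ab: "a \<in> generate W J" "b \<in> generate W I" "y = a \<otimes> x \<otimes> b"
      using y by (auto simp: double_coset_iff)
    have c: "a \<in> carrier W" "b \<in> carrier W" using ab sub by auto
    have "?j \<star> y \<star> ?i = ?j \<star> (a \<otimes> x) \<star> ?i"
      using mult_demazure_longest[OF I ab(2), of "a \<otimes> x"] ab c x by (simp add: demazure_assoc)
    also have "\<dots> = ?m" using longest_demazure_mult[OF J ab(1) x] by simp
    finally show ?thesis .
  qed
  have mem: "?m \<in> ?p" using longest_demazure_longest_mem[OF J I x] .
  have le: "len y \<le> len ?m" if y: "y \<in> ?p" for y
  proof -
    have yc: "y \<in> carrier W" using double_coset_closed[OF sub x y] .
    have "len y \<le> len (?j \<star> y)" using demazure_cases(1)[of ?j y] yc by auto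
    also have "\<dots> \<le> len (?j \<star> y \<star> ?i)" using demazure_cases(2)[of "?j \<star> y" ?i] yc by auto
    finally show ?thesis using const[OF y] by simp
  qed
  \<comment> \<open>A maximal \<open>y\<close> is not increased by the generators in \<open>J\<close> and \<open>I\<close>, hence it absorbs \<open>w\<^sub>J\<close> and \<open>w\<^sub>I\<close>.\<close>
  have uniq: "y = ?m" if y: "y \<in> ?p" and max: "\<not> (\<exists>z\<in>?p. bruhat_less W S y z)" for y
  proof -
    have yc: "y \<in> carrier W" using double_coset_closed[OF sub x y] .
    have py: "?p = double_coset W J y I" using double_coset_eq[OF sub x y] by simp
    have "s \<star> y = y" if "s \<in> J" for s
    proof -
      have s: "s \<in> S" "s \<in> generate W J" using that sub by (auto intro: generate.incl)
      then have "s \<otimes> y \<in> ?p" unfolding py double_coset_iff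
        using yc by (intro bexI[of _ s] bexI[of _ \<one>]) (auto intro: generate.one)
      then show ?thesis using bruhat_less_gen_mult[of s y] max s yc by (auto simp: up_left_def)
    qed
    then have j: "?j \<star> y = y"
      using parabolic_demazure_absorb(1)[OF sub(1) longest_elt(1)[OF J] yc] by blast
    have "y \<star> s = y" if "s \<in> I" for s
    proof -
      have s: "s \<in> S" "s \<in> generate W I" using that sub by (auto intro: generate.incl)
      then have "y \<otimes> s \<in> ?p" unfolding py double_coset_iff
        using yc by (intro bexI[of _ \<one>] bexI[of _ s]) (auto intro: generate.one)
      then show ?thesis using bruhat_less_mult_gen(1)[of s y] max s yc by (auto simp: up_right_def)
    qed
    then have "y \<star> ?i = y"
      using parabolic_demazure_absorb(2)[OF sub(2) longest_elt(1)[OF I] yc] by blast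
    then show ?thesis using const[OF y] j by simp
  qed
  show ?thesis
    unfolding max_elt_def
  proof (rule the_equality)
    show "?m \<in> ?p \<and> \<not> (\<exists>y\<in>?p. bruhat_less W S ?m y)"
      using mem le bruhat_less_imp_len by (meson not_le)
  qed (use uniq in blast)
qed

lemma max_elt_hom:
  assumes J: "finitary W S J" and I: "finitary W S I" and p: "p \<in> double_cosets W J I"
  shows "max_elt W S p \<in> carrier W"
    and "longest_elt W S J \<star> max_elt W S p = max_elt W S p"
    and "max_elt W S p \<star> longest_elt W S I = max_elt W S p"
    and "double_coset W J (max_elt W S p) I = p"
proof -
  let ?j = "longest_elt W S J" and ?i = "longest_elt W S I"
  have sub: "J \<subseteq> S" "I \<subseteq> S" using J I by (auto simp: finitary_def)
  obtain x where x: "x \<in> carrier W" "p = double_coset W J x I"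
    using p by (auto simp: double_cosets_def)
  have m: "max_elt W S p = ?j \<star> x \<star> ?i" using max_elt_double_coset[OF J I x(1)] x(2) by simp
  have ij: "?i \<in> carrier W" "?j \<in> carrier W" using I J by auto
  show "max_elt W S p \<in> carrier W" unfolding m using x ij by simp
  have "?j \<star> (?j \<star> x \<star> ?i) = ?j \<star> ?j \<star> x \<star> ?i" using x ij by (simp add: demazure_assoc)
  then show "?j \<star> max_elt W S p = max_elt W S p" unfolding m longest_elt_idem[OF J] .
  have "?j \<star> x \<star> ?i \<star> ?i = ?j \<star> x \<star> (?i \<star> ?i)" using x ij by (simp add: demazure_assoc)
  then show "max_elt W S p \<star> ?i = max_elt W S p" unfolding m longest_elt_idem[OF I] .
  show "double_coset W J (max_elt W S p) I = p"
    unfolding m using double_coset_eq[OF sub x(1) longest_demazure_longest_mem[OF J I x(1)]] x(2)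
    by simp
qed

section \<open>The equivalence\<close>

lemma bij_betw_max_elt:
  assumes J: "finitary W S J" and I: "finitary W S I"
  shows "bij_betw (max_elt W S) (double_cosets W J I)
    {w \<in> carrier W. longest_elt W S J \<star> w = w \<and> w = w \<star> longest_elt W S I}"
proof (rule bij_betw_byWitness[where f' = "\<lambda>w. double_coset W J w I"])
  show "\<forall>p\<in>double_cosets W J I. double_coset W J (max_elt W S p) I = p"
    using max_elt_hom(4)[OF J I] by blast
  show "\<forall>w\<in>{w \<in> carrier W. longest_elt W S J \<star> w = w \<and> w = w \<star> longest_elt W S I}.
      max_elt W S (double_coset W J w I) = w"
    using max_elt_double_coset[OF J I] by auto
  show "max_elt W S ` double_cosets W J I
      \<subseteq> {w \<in> carrier W. longest_elt W S J \<star> w = w \<and> w = w \<star> longest_elt W S I}"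
    using max_elt_hom(1-3)[OF J I] by auto
  show "(\<lambda>w. double_coset W J w I) `
      {w \<in> carrier W. longest_elt W S J \<star> w = w \<and> w = w \<star> longest_elt W S I}
      \<subseteq> double_cosets W J I"
    by (auto simp: double_cosets_def)
qed

lemma max_elt_identity:
  assumes "finitary W S I"
  shows "max_elt W S (double_coset W I \<one> I) = longest_elt W S I"
  using max_elt_double_coset[OF assms assms] assms longest_elt_idem[OF assms] by simp

text \<open>The factors \<open>w\<^sub>K\<close> and \<open>w\<^sub>I\<close> of the maximal element of the composite are absorbed by the outer ends of
  the product.\<close>

lemma max_elt_comp:
  assumes I: "finitary W S I" and J: "finitary W S J" and K: "finitary W S K"
    and q: "q \<in> double_cosets W J I" and p: "p \<in> double_cosets W K J"
  shows "max_elt W S (double_coset W K (max_elt W S p \<star> max_elt W S q) I)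
    = max_elt W S p \<star> max_elt W S q"
proof -
  note P = max_elt_hom[OF K J p] and Q = max_elt_hom[OF J I q]
  have "longest_elt W S K \<star> (max_elt W S p \<star> max_elt W S q) \<star> longest_elt W S I
      = (longest_elt W S K \<star> max_elt W S p) \<star> (max_elt W S q \<star> longest_elt W S I)"
    using P(1) Q(1) I K by (simp add: demazure_assoc)
  then show ?thesis using max_elt_double_coset[OF K I] P Q by simp
qed

abbreviation SC :: "('a set, 'a set) cat" where "SC \<equiv> singular_coxeter_monoid W S"
abbreviation Kar :: "('a, 'a) cat" where "Kar \<equiv> karoubi (coxeter_monoid W S)"

lemma SC_simps:
  "Ob SC = {I. finitary W S I}"
  "Hom SC I J = double_cosets W J I"
  "Cmp SC I J K p q = double_coset W K (max_elt W S p \<star> max_elt W S q) I"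
  "Idn SC I = double_coset W I \<one> I"
  by (simp_all add: singular_coxeter_monoid_def coxeter_monoid_eq)

lemma Kar_simps:
  "Ob Kar = {e \<in> carrier W. e \<star> e = e}"
  "Hom Kar e f = {w \<in> carrier W. f \<star> w = w \<and> w = w \<star> e}"
  "Cmp Kar e f g v w = v \<star> w"
  "Idn Kar e = e"
  by (simp_all add: karoubi_def coxeter_monoid_eq)

text \<open>All laws are transported from the monoid, since a double coset is determined by its maximal
  element and maximal elements multiply.\<close>

lemma SC_is_category: "is_category SC"
  unfolding is_category_def SC_simps
proof (intro conjI ballI; (unfold mem_Collect_eq)?)
  fix I assume I: "finitary W S I"
  show "double_coset W I \<one> I \<in> double_cosets W I I" by (auto simp: double_cosets_def)
next
  fix I J K q p
  assume *: "finitary W S I" "finitary W S J" "finitary W S K"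
    "q \<in> double_cosets W J I" "p \<in> double_cosets W K J"
  show "double_coset W K (max_elt W S p \<star> max_elt W S q) I \<in> double_cosets W K I"
    using max_elt_hom(1)[OF *(3,2,5)] max_elt_hom(1)[OF *(2,1,4)] by (auto simp: double_cosets_def)
next
  fix I J p assume *: "finitary W S I" "finitary W S J" "p \<in> double_cosets W J I"
  note P = max_elt_hom[OF *(2,1,3)]
  show "double_coset W J (max_elt W S p \<star> max_elt W S (double_coset W I \<one> I)) I = p"
    unfolding max_elt_identity[OF *(1)] P(3) by (rule P(4))
  show "double_coset W J (max_elt W S (double_coset W J \<one> J) \<star> max_elt W S p) I = p"
    unfolding max_elt_identity[OF *(2)] P(2) by (rule P(4))
next
  fix I J K L p q r
  assume *: "finitary W S I" "finitary W S J" "finitary W S K" "finitary W S L"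
    "p \<in> double_cosets W J I" "q \<in> double_cosets W K J" "r \<in> double_cosets W L K"
  show "double_coset W L (max_elt W S (double_coset W L (max_elt W S r \<star> max_elt W S q) J)
        \<star> max_elt W S p) I =
      double_coset W L (max_elt W S r
        \<star> max_elt W S (double_coset W K (max_elt W S q \<star> max_elt W S p) I)) I"
    unfolding max_elt_comp[OF *(2-4,6,7)] max_elt_comp[OF *(1-3,5,6)]
    using max_elt_hom(1)[OF *(2,1,5)] max_elt_hom(1)[OF *(3,2,6)] max_elt_hom(1)[OF *(4,3,7)]
    by (simp add: demazure_assoc)
qed

lemma Kar_is_category: "is_category Kar"
proof -
  have "monoid (coxeter_monoid W S)"
    using demazure_is_coxeter_product unfolding coxeter_monoid_eq is_coxeter_product_def by blast
  then show ?thesis by (rule karoubi_is_category)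
qed

lemma functor_SC_Kar: "is_functor SC Kar (SC_to_Kar W S)"
  unfolding is_functor_def
proof (intro conjI ballI)
  show "is_category SC" "is_category Kar" by (rule SC_is_category, rule Kar_is_category)
qed (auto simp: SC_simps Kar_simps SC_to_Kar_def longest_elt_idem max_elt_hom max_elt_identity
      max_elt_comp simp del: demazure_gen)

lemma equivalence_SC_Kar: "is_equivalence SC Kar (SC_to_Kar W S)"
proof (rule fully_faithful_surjective_imp_equivalence[OF functor_SC_Kar])
  show "ob_map (SC_to_Kar W S) ` Ob SC = Ob Kar"
    using idempotent_is_longest longest_elt_idem
    by (auto simp: SC_simps Kar_simps SC_to_Kar_def image_iff)
  fix I J assume "I \<in> Ob SC" "J \<in> Ob SC"
  then have "finitary W S I" "finitary W S J" by (simp_all add: SC_simps)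
  then show "bij_betw (hom_map (SC_to_Kar W S) I J) (Hom SC I J)
      (Hom Kar (ob_map (SC_to_Kar W S) I) (ob_map (SC_to_Kar W S) J))"
    using bij_betw_max_elt[of J I] by (simp add: SC_simps Kar_simps SC_to_Kar_def)
qed

end

theorem theorem2p11:
  fixes W :: "('a, 'b) monoid_scheme" and S :: "'a set"
  assumes "coxeter_system W S"
  shows "is_functor (singular_coxeter_monoid W S) (karoubi (coxeter_monoid W S)) (SC_to_Kar W S)
    \<and> is_equivalence (singular_coxeter_monoid W S) (karoubi (coxeter_monoid W S)) (SC_to_Kar W S)"
proof -
  have "group W" using assms by (simp add: coxeter_system_def)
  then interpret coxeter W S
    using assms by (intro coxeter.intro coxeter_axioms.intro)
  show ?thesis using functor_SC_Kar equivalence_SC_Kar by blast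
qed

end
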